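(* Let $p,q$ be primes with $\gcd(p-1,q-1)=8$. Then for every common primitive root $g$ of $p$ and $q$, the linear complexity (over $\mathrm{GF}(2)$) of the Ding-Helleseth generalized cyclotomic sequence of order $8$ with respect to $(p,q,g)$ is $$L(p,q)=pq-1-\varepsilon\,(p-1)-\kappa\,(q-1)-\theta\,(p-1)(q-1),$$ where $$\varepsilon=\begin{cases}\frac12,&\text{if }\left(\frac{2}{p}\right)_8=1,\\ 0,&\text{otherwise,}\end{cases}\qquad \kappa=\begin{cases}\frac12,&\text{if }\left(\frac{2}{q}\right)_8=1,\\ 0,&\text{otherwise,}\end{cases}$$ $$\theta=\begin{cases}\frac12,&\text{if }\left(\frac{2}{p}\right)_8=1\text{ and }\left(\frac{2}{q}\right)_4=1,\\[2pt] \frac12,&\text{if }\left(\frac{2}{p}\right)_8=1,\ \left(\frac{2}{q}\right)_4\neq1\text{ and }\left(\frac{p}{q}\right)_4=1,\\[2pt] \frac12,&\text{if }\left(\frac{2}{p}\right)_4=1,\ \left(\frac{2}{p}\right)_8\neq1,\ \left(\frac{2}{q}\right)_4\neq1,\ \left(\frac{p}{q}\right)_2=1\text{ and }\left(\frac{p}{q}\right)_4\neq1,\\[2pt] \frac14,&\text{if }\left(\frac{2}{p}\right)_4=1,\ \left(\frac{2}{q}\right)_4\neq1\text{ and }\left(\frac{p}{q}\right)_2\neq1,\\[2pt] 0,&\text{otherwise.}\end{cases}$$ In particular, the linear complexity does not depend on the choice of $g$.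
   Context: Power residue symbol: for a prime $p$, an integer $c$ and a positive integer $k$, write $\left(\frac{c}{p}\right)_k=1$ if and only if there is an integer $u$ with $u^k\equiv c\not\equiv 0 \pmod p$; otherwise $\left(\frac{c}{p}\right)_k\neq1$. Linear complexity: for a sequence $(s_i)_{i\ge0}$ over a field $F$, the linear complexity is the least positive integer $L$ such that there exist constants $c_1,\dots,c_L\in F$ with $s_i+c_1s_{i-1}+\cdots+c_Ls_{i-L}=0$ for all $i\ge L$. Here $F=\mathrm{GF}(2)$. Ding-Helleseth generalized cyclotomic sequence: let $p,q$ be distinct odd primes, $d=\gcd(p-1,q-1)$ and $e=\mathrm{lcm}(p-1,q-1)=(p-1)(q-1)/d$. Let $g$ be an integer that is a primitive root modulo both $p$ and $q$ (a common primitive root), and let $f$ be an integer with $f\equiv g\pmod p$ and $f\equiv1\pmod q$. For $i\in\mathbb{Z}$ define the following subsets of $\mathbb{Z}_{pq}=\mathbb{Z}/pq\mathbb{Z}$, where $[m \bmod pq]$ denotes the residue class of $m$: $$D_i=\{[g^{i+dt}f^v \bmod pq]: 0\le t\le \tfrac{e}{d}-1,\ 0\le v\le d-1\},$$ $$P_i=\{[p\,g^{i+dt}\bmod pq]: 0\le t\le \tfrac{q-1}{d}-1\},\qquad Q_i=\{[q\,g^{i+dt}\bmod pq]: 0\le t\le \tfrac{p-1}{d}-1\}.$$ The Ding-Helleseth generalized cyclotomic sequence of order $d$ with respect to $(p,q,g)$ is the binary sequence $(s_i)_{i\ge0}$ over $\mathrm{GF}(2)$ with $s_i=1$ if $[i\bmod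 pq]\in\bigcup_{j=d/2}^{d-1}(D_j\cup P_j\cup Q_j)$, and $s_i=0$ otherwise. In the claim, $d=8$. *)

theory Defs
  imports Complex_Main "HOL-Library.Z2" "HOL-Number_Theory.Number_Theory"
begin

definition linear_complexity :: "(nat \<Rightarrow> 'a::field) \<Rightarrow> nat" where
  "linear_complexity s =
    (LEAST L. 0 < L \<and> (\<exists>c :: nat \<Rightarrow> 'a. \<forall>i\<ge>L. s i + (\<Sum>k=1..L. c k * s (i - k)) = 0))"

(* "power_residue k c p" is the assertion that the k-th power residue symbol (c/p) equals 1;
   its negation is the assertion that the symbol differs from 1. *)
definition power_residue :: "nat \<Rightarrow> int \<Rightarrow> nat \<Rightarrow> bool" where
  "power_residue k c p \<longleftrightarrow> (\<exists>u::int. [u ^ k = c] (mod int p)) \<and> \<not> [c = 0] (mod int p)"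

(* The library notion residue_primroot lives on the naturals, so the integer g is first
   replaced by its least nonnegative residue. *)
definition common_primitive_root :: "nat \<Rightarrow> nat \<Rightarrow> int \<Rightarrow> bool" where
  "common_primitive_root p q g \<longleftrightarrow>
     residue_primroot p (nat (g mod int p)) \<and> residue_primroot q (nat (g mod int q))"

(* Elements of Z/pq are represented by their least nonnegative residues.  Only the classes
   with index d/2, ..., d - 1 enter the sequence, so a natural index suffices and no inverse
   of g modulo pq is needed. *)

definition DH_D :: "nat \<Rightarrow> nat \<Rightarrow> int \<Rightarrow> int \<Rightarrow> nat \<Rightarrow> int set" where
  "DH_D p q g f i =
    (let d = gcd (p - 1) (q - 1); e = lcm (p - 1) (q - 1)
     in {(g ^ (i + d * t) * f ^ v) mod int (p * q) | t v. t < e div d \<and> v < d})"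

definition DH_P :: "nat \<Rightarrow> nat \<Rightarrow> int \<Rightarrow> nat \<Rightarrow> int set" where
  "DH_P p q g i =
    (let d = gcd (p - 1) (q - 1)
     in {(int p * g ^ (i + d * t)) mod int (p * q) | t. t < (q - 1) div d})"

definition DH_Q :: "nat \<Rightarrow> nat \<Rightarrow> int \<Rightarrow> nat \<Rightarrow> int set" where
  "DH_Q p q g i =
    (let d = gcd (p - 1) (q - 1)
     in {(int q * g ^ (i + d * t)) mod int (p * q) | t. t < (p - 1) div d})"

(* The auxiliary integer f is an explicit argument; it is meant to satisfy the congruences
   f = g modulo p and f = 1 modulo q, which determine it modulo pq. *)
definition DH_sequence :: "nat \<Rightarrow> nat \<Rightarrow> int \<Rightarrow> int \<Rightarrow> nat \<Rightarrow> bit" where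
  "DH_sequence p q g f i =
    (let d = gcd (p - 1) (q - 1)
     in if int i mod int (p * q) \<in> (\<Union>j\<in>{d div 2..d - 1}. DH_D p q g f j \<union> DH_P p q g j \<union> DH_Q p q g j)
        then 1 else 0)"

definition DH_parameters :: "nat \<Rightarrow> nat \<Rightarrow> int \<Rightarrow> int \<Rightarrow> bool" where
  "DH_parameters p q g f \<longleftrightarrow>
     common_primitive_root p q g \<and> [f = g] (mod int p) \<and> [f = 1] (mod int q)"

definition eps :: "nat \<Rightarrow> real" where
  "eps p = (if power_residue 8 2 p then 1/2 else 0)"

definition kappa :: "nat \<Rightarrow> real" where
  "kappa q = (if power_residue 8 2 q then 1/2 else 0)"

definition theta :: "nat \<Rightarrow> nat \<Rightarrow> real" where
  "theta p q =
    (if power_residue 8 2 p \<and> power_residue 4 2 q then 1/2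
     else if power_residue 8 2 p \<and> \<not> power_residue 4 2 q \<and> power_residue 4 (int p) q then 1/2
     else if power_residue 4 2 p \<and> \<not> power_residue 8 2 p \<and> \<not> power_residue 4 2 q
             \<and> power_residue 2 (int p) q \<and> \<not> power_residue 4 (int p) q then 1/2
     else if power_residue 4 2 p \<and> \<not> power_residue 4 2 q \<and> \<not> power_residue 2 (int p) q then 1/4
     else 0)"

end

theory Submission
  imports "HOL-Algebra.Algebraic_Closure_Type" Defs
begin

text \<open>
  The linear complexity of a sequence of odd period $N = pq$ is the number of $N$-th roots of
  unity $x$, in an algebraic closure of $\mathrm{GF}(2)$, at which the generating polynomial of one
  period does not vanish.  Write $x = uv$ with $u^p = v^q = 1$, and let $T_p(u)$ be the sum of the
  $u^y$ over the $y$ whose index modulo $p$ lies in the classes $4, \ldots, 7$ modulo $8$.  Then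
  the value at $x$ is $[u \neq 1]\, T_q(v) + T_q(v^p) + T_p(u^q)$.

  The value $T$ increases by $1$ when the index of its argument is shifted by $4$, and squaring
  it shifts that index by the index of $2$.  Hence the Artin-Schreier value $T^2 + T$ is $0$ if $2$
  is an eighth power, $1$ if $2$ is only a fourth power, and otherwise a primitive cube root of
  unity that changes to the other one when the index moves by $2$.  Comparing these values for the two sides
  of $T_q(v) + T_q(v^p) = T_p(u^q)$ decides how often it holds, because an Artin-Schreier value
  determines $T$ up to adding $1$.
\<close>

subsection \<open>Linear complexity and roots of unity\<close>

type_synonym gf2_closure = "bit alg_closure"

lemma CHAR_bit [simp]: "CHAR(bit) = 2"
proof (rule CHAR_eqI)
  show "2 dvd n" if "of_nat n = (0 :: bit)" for n
    using that by (cases "even n") (auto elim!: oddE)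
qed simp

lemma CHAR_gf2_closure: "CHAR(gf2_closure) = 2"
  by simp

lemma add_self [simp]: "x + x = (0 :: gf2_closure)"
proof -
  have "of_nat 2 = (0 :: gf2_closure)"
    using of_nat_CHAR[where 'a = gf2_closure] CHAR_gf2_closure by simp
  hence "(2 :: gf2_closure) = 0" by simp
  hence "2 * x = 0" by simp
  thus ?thesis by (simp only: mult_2)
qed

lemma uminus_eq_self [simp]: "- x = (x :: gf2_closure)"
  by (metis add_self add_eq_0_iff)

lemma add_eq_0_iff_eq: "x + y = 0 \<longleftrightarrow> x = (y :: gf2_closure)"
  by (metis add_eq_0_iff uminus_eq_self)

lemma add_self_left [simp]: "x + (x + y) = (y :: gf2_closure)"
  by (simp flip: add.assoc)

lemma of_nat_eq_0_iff_even: "of_nat n = (0 :: gf2_closure) \<longleftrightarrow> even n"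
  by (simp add: of_nat_eq_0_iff_char_dvd)

lemma two_eq_0 [simp]: "(2 :: gf2_closure) = 0"
  using add_self[of 1] by (simp only: one_add_one)

lemma of_nat_odd: "odd n \<Longrightarrow> of_nat n = (1 :: gf2_closure)"
  by (auto elim: oddE)

lemma add_eq_iff: "x + y = z \<longleftrightarrow> x = z + (y :: gf2_closure)"
  by (auto simp: add.assoc)

lemma square_add: "(x + y)\<^sup>2 = x\<^sup>2 + (y\<^sup>2 :: gf2_closure)"
  by (rule freshmans_dream) simp_all

lemma square_sum: "(\<Sum>i\<in>A. f i)\<^sup>2 = (\<Sum>i\<in>A. (f i :: gf2_closure)\<^sup>2)"
  by (rule freshmans_dream_sum) simp_all

lemma square_eq_iff: "x\<^sup>2 = y\<^sup>2 \<longleftrightarrow> x = (y :: gf2_closure)"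
  by (metis add_eq_0_iff_eq square_add zero_eq_power2)

lemma inj_square: "inj (\<lambda>x. (x :: gf2_closure)\<^sup>2)"
  by (simp add: inj_def square_eq_iff)

text \<open>A root of x(x - 1) is 0 or 1. This is how the feedback polynomial built below descends
  from the closure to GF(2).\<close>

lemma in_range_to_ac:
  assumes "x\<^sup>2 = x" shows "x \<in> range (to_ac :: bit \<Rightarrow> gf2_closure)"
proof -
  have "x * (x - 1) = 0" using assms by (simp add: power2_eq_square algebra_simps)
  hence "x = to_ac 0 \<or> x = to_ac 1" by auto
  thus ?thesis by blast
qed

text \<open>The Frobenius map is a ring homomorphism, so applying it to all coefficients respects
  products of polynomials.\<close>

lemma map_poly_square_mult:
  "map_poly (\<lambda>x. x\<^sup>2) (P * Q :: gf2_closure poly) = map_poly (\<lambda>x. x\<^sup>2) P * map_poly (\<lambda>x. x\<^sup>2) Q"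
  by (rule poly_eqI) (simp add: coeff_map_poly coeff_mult square_sum power_mult_distrib)

lemma map_poly_square_prod:
  "map_poly (\<lambda>x. x\<^sup>2) (\<Prod>i\<in>A. P i :: gf2_closure poly) = (\<Prod>i\<in>A. map_poly (\<lambda>x. x\<^sup>2) (P i))"
  by (induction A rule: infinite_finite_induct) (simp_all add: map_poly_square_mult)

section \<open>The discrete Fourier transform of a period\<close>

lemma sum_shift_period:
  fixes F :: "nat \<Rightarrow> 'a :: cancel_comm_monoid_add"
  assumes "\<And>i. F (i + N) = F i"
  shows "(\<Sum>i<N. F (i + a)) = (\<Sum>i<N. F i)"
proof (induction a)
  case (Suc a)
  have "(\<Sum>i<N. F (i + Suc a)) + F a = (\<Sum>i<Suc N. F (i + a))"
    by (subst sum.lessThan_Suc_shift) (simp add: add.commute)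
  also have "\<dots> = (\<Sum>i<N. F (i + a)) + F a"
    using assms[of a] by (simp add: add.commute)
  finally show ?case using Suc by simp
qed simp

definition dft :: "nat \<Rightarrow> (nat \<Rightarrow> gf2_closure) \<Rightarrow> gf2_closure \<Rightarrow> gf2_closure" where
  "dft N s x = (\<Sum>i<N. s i * x ^ i)"

text \<open>The \<open>t i\<close> are the coefficients of a polynomial of degree below
  \<open>N\<close> that has \<open>N\<close> distinct zeros.\<close>

lemma dft_inject:
  assumes "card {x :: gf2_closure. x ^ N = 1} = N"
    and "\<And>x. x ^ N = 1 \<Longrightarrow> dft N t x = 0" and "i < N"
  shows "t i = 0"
proof -
  define P where "P = (\<Sum>i<N. monom (t i) i)"
  have coeff: "coeff P j = (if j < N then t j else 0)" for j
    by (simp add: P_def coeff_sum)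
  have "P = 0"
  proof (rule ccontr)
    assume "P \<noteq> 0"
    have "N = card {x :: gf2_closure. x ^ N = 1}" using assms(1) by simp
    also have "\<dots> \<le> card {x. poly P x = 0}"
      using assms(2) \<open>P \<noteq> 0\<close>
      by (intro card_mono poly_roots_finite) (auto simp: P_def poly_sum poly_monom dft_def)
    also have "\<dots> \<le> degree P"
      by (rule card_poly_roots_bound) fact
    also have "\<dots> < N"
      using \<open>i < N\<close> by (intro degree_lessI) (auto simp: coeff \<open>P \<noteq> 0\<close>)
    finally show False by simp
  qed
  thus ?thesis using coeff[of i] \<open>i < N\<close> by simp
qed

text \<open>At an \<open>N\<close>-th root of unity the terms \<open>s i * x ^ i\<close> are
  periodic, so their sum over any \<open>N\<close> consecutive indices is the transform. A
  recurrence therefore acts on the transform as multiplication by the value of its feedback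
  polynomial.\<close>

lemma dft_filter:
  assumes per: "\<And>i. s (i + N) = s i" and x: "x ^ N = 1"
  shows "(\<Sum>i<N. (s (i + L) + (\<Sum>k=1..L. c k * s (i + L - k))) * x ^ (i + L))
       = dft N s x * (1 + (\<Sum>k=1..L. c k * x ^ k))"
proof -
  have shift: "(\<Sum>i<N. s (i + a) * x ^ (i + a)) = dft N s x" for a
    unfolding dft_def
    by (rule sum_shift_period[where F = "\<lambda>i. s i * x ^ i"]) (simp add: per power_add x)
  have "(\<Sum>i<N. (s (i + L) + (\<Sum>k=1..L. c k * s (i + L - k))) * x ^ (i + L))
      = (\<Sum>i<N. s (i + L) * x ^ (i + L))
        + (\<Sum>i<N. \<Sum>k=1..L. c k * x ^ k * (s (i + (L - k)) * x ^ (i + (L - k))))"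
    unfolding sum.distrib[symmetric] distrib_right sum_distrib_right
    by (intro sum.cong arg_cong2[of _ _ _ _ "(+)"] refl)
       (auto simp: power_add[symmetric] mult_ac simp flip: power_add)
  also have "(\<Sum>i<N. \<Sum>k=1..L. c k * x ^ k * (s (i + (L - k)) * x ^ (i + (L - k))))
      = (\<Sum>k=1..L. c k * x ^ k * dft N s x)"
    by (subst sum.swap) (simp only: shift sum_distrib_left[symmetric])
  finally show ?thesis
    by (simp add: shift algebra_simps sum_distrib_left)
qed

text \<open>This is Blahut's theorem. The feedback polynomial of a valid recurrence vanishes on the
  support of the transform, which bounds the length from below; conversely, the polynomial with
  exactly these roots yields a recurrence. A nonzero term makes the support nonempty, in accordance
  with the condition \<open>0 < L\<close>.\<close>

theorem linear_complexity_eq_card_dft_support: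
  fixes s :: "nat \<Rightarrow> bit"
  assumes card: "card {x :: gf2_closure. x ^ N = 1} = N"
    and per: "\<And>i. s (i + N) = s i" and "s i0 \<noteq> 0" and N: "N > 0"
  shows "linear_complexity s = card {x. x ^ N = 1 \<and> dft N (\<lambda>i. to_ac (s i)) x \<noteq> 0}"
proof -
  define A where "A = dft N (\<lambda>i. to_ac (s i))"
  define J where "J = {x. x ^ N = 1 \<and> A x \<noteq> 0}"
  have fin: "finite J"
  proof -
    have "finite {x :: gf2_closure. x ^ N = 1}"
      using card N by (metis card.infinite less_numeral_extra(3))
    thus ?thesis by (rule rev_finite_subset) (auto simp: J_def)
  qed
  have ident: "(\<Sum>i<N. to_ac (s (i + L) + (\<Sum>k=1..L. c k * s (i + L - k))) * x ^ (i + L))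
      = A x * (1 + (\<Sum>k=1..L. to_ac (c k) * x ^ k))" if "x ^ N = 1" for x L and c :: "nat \<Rightarrow> bit"
    unfolding A_def to_ac_add to_ac_sum to_ac_mult
    by (rule dft_filter) (simp_all add: per that)

  have lower: "card J \<le> L" if "\<forall>i\<ge>L. s i + (\<Sum>k=1..L. c k * s (i - k)) = 0" for L c
  proof -
    define R :: "gf2_closure poly" where "R = 1 + (\<Sum>k=1..L. monom (to_ac (c k)) k)"
    have "coeff R 0 = 1"
      unfolding R_def by (simp add: coeff_sum)
    hence "R \<noteq> 0" by auto
    have "poly R x = 0" if "x \<in> J" for x
    proof -
      have "s (i + L) + (\<Sum>k=1..L. c k * s (i + L - k)) = 0" for i
        using \<open>\<forall>i\<ge>L. _\<close>[rule_format, of "i + L"] by simp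
      hence "A x * (1 + (\<Sum>k=1..L. to_ac (c k) * x ^ k)) = 0"
        using ident[of x L c] that by (simp add: J_def)
      thus ?thesis using that
        by (simp add: J_def R_def poly_sum poly_monom)
    qed
    hence "card J \<le> card {x. poly R x = 0}"
      using \<open>R \<noteq> 0\<close> by (intro card_mono poly_roots_finite) auto
    also have "\<dots> \<le> degree R" by (rule card_poly_roots_bound) fact
    also have "\<dots> \<le> L" unfolding R_def
      by (intro degree_add_le degree_sum_le) (auto intro!: order.trans[OF degree_monom_le])
    finally show ?thesis .
  qed

  \<comment> \<open>\<open>J\<close> is closed under squaring, so this polynomial is fixed by the Frobenius map and has
    coefficients in \<open>GF(2)\<close>.\<close>
  define R where "R = (\<Prod>x\<in>J. [:1, inverse x:])"
  have "J \<noteq> {}"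
  proof
    assume "J = {}"
    \<comment> \<open>A transform that vanishes at all roots of unity forces a zero period, hence a
      zero sequence.\<close>
    hence "to_ac (s (i0 mod N)) = (0 :: gf2_closure)"
      using card N by (intro dft_inject[of N "\<lambda>i. to_ac (s i)"]) (auto simp: J_def A_def)
    moreover have "s (i + k * N) = s i" for i k
      by (induction k) (use per in \<open>simp_all add: add.assoc[symmetric] add.commute[of N]\<close>)
    from this[of "i0 mod N" "i0 div N"] have "s (i0 mod N) = s i0" by simp
    ultimately show False using \<open>s i0 \<noteq> 0\<close> by simp
  qed
  have sq_J: "(\<lambda>x. x\<^sup>2) ` J = J"
  proof (rule card_subset_eq[OF fin])
    \<comment> \<open>Terms in GF(2) are fixed by squaring, so the transform commutes with the
      Frobenius map.\<close>
    have "(to_ac b :: gf2_closure)\<^sup>2 = to_ac b" for b :: bit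
      by (cases b) simp_all
    hence "A (x\<^sup>2) = (A x)\<^sup>2" for x
      by (simp add: A_def dft_def square_sum power_mult_distrib power_mult[symmetric] mult.commute)
    thus "(\<lambda>x. x\<^sup>2) ` J \<subseteq> J"
      by (auto simp: J_def power_mult[symmetric] mult.commute[of 2]) (simp add: power_mult)
    show "card ((\<lambda>x. x\<^sup>2) ` J) = card J"
      by (rule card_image) (use inj_square in \<open>auto simp: inj_on_def\<close>)
  qed
  have "map_poly (\<lambda>x. x\<^sup>2) R = (\<Prod>x\<in>J. [:1, inverse (x\<^sup>2):])"
    by (simp add: R_def map_poly_square_prod map_poly_pCons power_inverse)
  also have "\<dots> = (\<Prod>x\<in>(\<lambda>x. x\<^sup>2) ` J. [:1, inverse x:])"
    by (subst prod.reindex) (use inj_square in \<open>auto simp: inj_on_def\<close>)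
  finally have R_sq: "map_poly (\<lambda>x. x\<^sup>2) R = R"
    by (simp add: sq_J R_def)
  define c :: "nat \<Rightarrow> bit" where "c k = of_ac (coeff R k)" for k
  have c: "to_ac (c k) = coeff R k" for k
    unfolding c_def
  proof (intro to_ac_of_ac in_range_to_ac)
    show "(coeff R k)\<^sup>2 = coeff R k"
      using arg_cong[OF R_sq, of "\<lambda>P. coeff P k"] by (simp add: coeff_map_poly)
  qed
  have "degree R \<le> card J"
    unfolding R_def using degree_prod_sum_le[OF fin, of "\<lambda>x. [:1, inverse x:]"]
    by (rule order.trans) (use sum_mono[of J "\<lambda>x. degree [:1, inverse x:]" "\<lambda>_. 1"] in auto)
  moreover have "coeff R 0 = 1"
    by (simp add: poly_0_coeff_0[symmetric] R_def poly_prod)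
  ultimately have poly_R: "poly R x = 1 + (\<Sum>k=1..card J. to_ac (c k) * x ^ k)" for x
  proof -
    assume deg: "degree R \<le> card J" and "coeff R 0 = 1"
    have "poly R x = (\<Sum>k\<le>card J. coeff R k * x ^ k)"
      unfolding poly_altdef using deg
      by (intro sum.mono_neutral_left) (auto simp: coeff_eq_0)
    also have "{..card J} = insert 0 {1..card J}" by auto
    finally show ?thesis by (simp add: c \<open>coeff R 0 = 1\<close>)
  qed
  have upper: "\<forall>i\<ge>card J. s i + (\<Sum>k=1..card J. c k * s (i - k)) = 0"
  proof -
    \<comment> \<open>\<open>t\<close> is the defect of the recurrence. Up to a power of
      \<open>x\<close> its transform is \<open>A x * poly R x\<close>, and at every root of unity
      one of the two factors is 0.\<close>
    define t where "t i = s (i + card J) + (\<Sum>k=1..card J. c k * s (i + card J - k))" for i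
    have t_per: "t (i + N) = t i" for i
    proof -
      have "s (i + N + card J - k) = s (i + card J - k)" if "k \<in> {1..card J}" for k
        using per[of "i + card J - k"] that by (simp add: algebra_simps)
      moreover have "s (i + N + card J) = s (i + card J)"
        using per[of "i + card J"] by (simp add: algebra_simps)
      ultimately show ?thesis unfolding t_def by (simp only: cong: sum.cong)
    qed
    have "to_ac (t i) = (0 :: gf2_closure)" if "i < N" for i
    proof (rule dft_inject[OF card _ that])
      fix x :: gf2_closure assume x: "x ^ N = 1"
      have "A x * poly R x = 0"
      proof (cases "x \<in> J")
        case True
        have "x \<noteq> 0" using x N by (auto simp: power_0_left)
        hence "poly [:1, inverse x:] x = 0" by simp
        hence "poly R x = 0" unfolding R_def poly_prod using True fin by (meson prod_zero)
        thus ?thesis by simp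
      qed (use x in \<open>simp add: J_def\<close>)
      hence "dft N (\<lambda>i. to_ac (t i)) x * x ^ card J = 0"
        using ident[OF x, of "card J" c]
        by (simp add: poly_R t_def dft_def sum_distrib_right power_add mult.assoc)
      thus "dft N (\<lambda>i. to_ac (t i)) x = 0" using x N by (auto simp: power_0_left)
    qed
    hence "t i = 0" if "i < N" for i using that by simp
    moreover have "t (i + k * N) = t i" for i k
      by (induction k) (use t_per in \<open>simp_all add: add.assoc[symmetric] add.commute[of N]\<close>)
    ultimately have t_0: "t i = 0" for i
      using N mod_div_mult_eq[of i N] mod_less_divisor[of N i] by metis
    show ?thesis
    proof (intro allI impI)
      fix i assume "i \<ge> card J"
      thus "s i + (\<Sum>k=1..card J. c k * s (i - k)) = 0"
        using t_0[of "i - card J"] unfolding t_def by (simp only: le_add_diff_inverse2)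
    qed
  qed
  show ?thesis
    unfolding linear_complexity_def A_def[symmetric] J_def[symmetric]
  proof (rule Least_equality)
    show "0 < card J \<and> (\<exists>c :: nat \<Rightarrow> bit. \<forall>i\<ge>card J. s i + (\<Sum>k=1..card J. c k * s (i - k)) = 0)"
      using \<open>J \<noteq> {}\<close> fin upper by (meson card_gt_0_iff)
    show "card J \<le> L" if "0 < L \<and> (\<exists>c :: nat \<Rightarrow> bit. \<forall>i\<ge>L. s i + (\<Sum>k=1..L. c k * s (i - k)) = 0)" for L
      using that lower by meson
  qed
qed

subsection \<open>Counting coincidences of octic sums\<close>

definition artin :: "gf2_closure \<Rightarrow> gf2_closure" where
  "artin x = x\<^sup>2 + x"

lemma artin_add: "artin (x + y) = artin x + artin y"
  by (simp add: artin_def square_add algebra_simps)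

lemma artin_1 [simp]: "artin 1 = 0"
  by (simp add: artin_def)

lemma artin_eq_0_iff: "artin x = 0 \<longleftrightarrow> x = 0 \<or> x = 1"
proof -
  have "artin x = x * (x + 1)" by (simp add: artin_def power2_eq_square algebra_simps)
  thus ?thesis by (simp add: add_eq_0_iff_eq)
qed

lemma artin_eq_iff: "artin x = artin y \<longleftrightarrow> y = x \<or> y = x + 1"
proof -
  have "artin x = artin y \<longleftrightarrow> artin (x + y) = 0"
    by (simp add: artin_add add_eq_0_iff_eq)
  also have "\<dots> \<longleftrightarrow> y = x \<or> y = x + 1"
    unfolding artin_eq_0_iff by (metis add_self_left add_eq_0_iff_eq)
  finally show ?thesis .
qed

text \<open>Translation by \<open>a\<close> permutes the residues of a period and exchanges
  \<open>P\<close> with its complement.\<close>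

lemma card_half_period:
  fixes P :: "nat \<Rightarrow> bool"
  assumes "\<And>i. P (i + N) = P i" and "\<And>i. P (i + a) \<longleftrightarrow> \<not> P i"
  shows "2 * card {i. i < N \<and> P i} = N"
proof -
  have card: "card {i. i < N \<and> P i} = (\<Sum>i<N. of_bool (P i))"
    by (simp add: lessThan_def Collect_conj_eq)
  have "(\<Sum>i<N. of_bool (P (i + a)) :: nat) = (\<Sum>i<N. of_bool (P i))"
    by (rule sum_shift_period) (simp add: assms(1))
  hence "2 * (\<Sum>i<N. of_bool (P i) :: nat) = (\<Sum>i<N. of_bool (P i) + of_bool (\<not> P i))"
    unfolding sum.distrib by (simp only: assms(2) mult_2)
  also have "\<dots> = (\<Sum>i<N. 1)" by (rule sum.cong) auto
  finally show ?thesis by (simp add: card)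
qed

text \<open>\<open>T i\<close> models the sum at the root of unity of index \<open>i\<close>, \<open>t\<close> is the index of \<open>2\<close>, and
  \<open>M\<close> is the order of the group of indices.\<close>

locale octic_sums =
  fixes T :: "nat \<Rightarrow> gf2_closure" and t M :: nat
  assumes add4: "T (i + 4) = T i + 1"
    and square: "(T i)\<^sup>2 = T (i + t)"
    and even_t: "even t"
    and period: "T (i + M) = T i"
begin

lemma add_mult4: "T (i + 4 * k) = T i + of_nat k"
proof (induction k)
  case (Suc k)
  have "T (i + 4 * Suc k) = T ((i + 4 * k) + 4)" by (simp add: algebra_simps)
  also have "\<dots> = T i + of_nat k + 1" unfolding add4 Suc ..
  finally show ?case by (simp add: add_ac)
qed simp

text \<open>Squaring is the shift by \<open>t\<close>, so it adds \<open>t div 4\<close>, which is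
  even here and hence 0 in characteristic 2.\<close>

lemma artin_octic: "8 dvd t \<Longrightarrow> artin (T i) = 0"
  using add_mult4[of i "t div 4"] by (auto simp: artin_def square add_ac elim!: dvdE)

lemma artin_quartic: assumes "4 dvd t" "\<not> 8 dvd t" shows "artin (T i) = 1"
proof -
  from assms obtain k where k: "t = 4 * k" "odd k" by (auto elim!: dvdE)
  have "of_nat k = (1 :: gf2_closure)"
    using k(2) by (rule of_nat_odd)
  thus ?thesis using add_mult4[of i k] by (simp add: artin_def square k add_ac)
qed

text \<open>Squaring twice shifts by \<open>2 * t\<close>, an odd multiple of 4, so T^4 = T + 1. The
  twofold Artin-Schreier map is x^4 + x, because the terms x^2 cancel.\<close>

lemma artin_artin: assumes "\<not> 4 dvd t" shows "artin (artin (T i)) = 1"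
proof -
  from assms even_t obtain k where k: "t = 2 * k" "odd k" by (auto elim!: dvdE)
  have "of_nat k = (1 :: gf2_closure)"
    using k(2) by (rule of_nat_odd)
  have "T (i + t + t) = T (i + 4 * k)" by (simp add: k algebra_simps)
  also have "\<dots> = T i + 1" using add_mult4[of i k] \<open>of_nat k = 1\<close> by simp
  finally have "((T i)\<^sup>2)\<^sup>2 = T i + 1" by (simp add: square)
  thus ?thesis by (simp add: artin_def square_add algebra_simps)
qed

text \<open>If the Artin-Schreier values agree, every \<open>T i\<close> is \<open>c\<close> or
  \<open>c + 1\<close>, and the shift by 4 swaps these two.\<close>

lemma card_eq:
  assumes "\<And>i. artin (T i) = \<delta>"
  shows "2 * card {l. l < M \<and> T l = c} = (if artin c = \<delta> then M else 0)"
proof (cases "artin c = \<delta>")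
  case True
  have "T (i + 4) = c \<longleftrightarrow> T i \<noteq> c" for i
  proof -
    have "c = T i \<or> c = T i + 1"
      using assms[of i] True by (simp flip: artin_eq_iff)
    thus ?thesis by (auto simp: add4)
  qed
  thus ?thesis using True period
    by (subst card_half_period[where a = 4]) auto
next
  case False
  hence "{l. l < M \<and> T l = c} = {}" using assms by auto
  thus ?thesis using False by simp
qed

text \<open>The twofold Artin-Schreier map sends \<open>c\<close> to 0 but every \<open>T i\<close>
  to 1.\<close>

lemma card_eq_0:
  assumes "\<not> 4 dvd t" "artin c = 0 \<or> artin c = 1"
  shows "{l. l < M \<and> T l = c} = {}"
proof -
  have "artin (artin c) = 0" using assms(2) by (auto simp: artin_eq_0_iff)
  thus ?thesis using artin_artin[OF assms(1)] by auto
qed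

lemma card_zeros: "2 * card {l. l < M \<and> T l = 0} = (if 8 dvd t then M else 0)"
proof (cases "8 dvd t")
  case True
  thus ?thesis by (subst card_eq[of 0]) (auto simp: artin_octic artin_eq_0_iff)
next
  case False
  have "{l. l < M \<and> T l = 0} = {}"
  proof (cases "4 dvd t")
    case True
    have "artin 0 = 0" by (simp add: artin_eq_0_iff)
    thus ?thesis using artin_quartic[OF True False] by (metis (mono_tags, lifting) Collect_empty_eq zero_neq_one)
  qed (rule card_eq_0, auto simp: artin_eq_0_iff)
  thus ?thesis using False by simp
qed

section \<open>Sums of two shifted values, the shape of T_q(v) + T_q(v^p)\<close>

definition shift_sum :: "nat \<Rightarrow> nat \<Rightarrow> gf2_closure" where
  "shift_sum m n = T n + T (n + m)"

lemma shift_sum_period: "shift_sum m (n + M) = shift_sum m n"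
  using period[of n] period[of "n + m"] by (simp add: shift_sum_def algebra_simps)

lemma artin_add4: "artin (T (i + 4 * k)) = artin (T i)"
  by (cases "even k") (simp_all add: add_mult4 artin_add of_nat_odd of_nat_eq_0_iff_even artin_eq_0_iff)

lemma artin_shift_sum_quartic: "4 dvd t \<Longrightarrow> artin (shift_sum m n) = 0"
  by (cases "8 dvd t") (simp_all add: shift_sum_def artin_add artin_octic artin_quartic)

lemma artin_shift_sum_0: "4 dvd m \<Longrightarrow> artin (shift_sum m n) = 0"
  by (auto simp: shift_sum_def artin_add artin_add4 elim!: dvdE)

text \<open>The shift by \<open>t\<close> squares a = \<open>artin (T n)\<close>, and a^2 + a = 1,
  so this shift adds 1. Every \<open>m\<close> congruent to 2 modulo 4 acts in the same way, since
  \<open>artin (T n)\<close> has period 4 in \<open>n\<close>.\<close>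

lemma artin_T_add2:
  assumes "\<not> 4 dvd t" "even m" "\<not> 4 dvd m"
  shows "artin (T (n + m)) = artin (T n) + 1"
proof -
  have "artin (T (n + t)) = artin (T n) + 1"
  proof -
    have "artin (T (n + t)) = (artin (T n))\<^sup>2"
      by (simp add: artin_def square_add flip: square)
    also have "\<dots> = artin (artin (T n)) + artin (T n)"
      by (simp add: artin_def[of "artin _"] add.assoc)
    finally show ?thesis by (simp add: artin_artin[OF assms(1)] add.commute)
  qed
  moreover have "artin (T (n + t)) = artin (T (n + m))"
  proof -
    have mod2: "k mod 4 = 2" if "even k" "\<not> 4 dvd k" for k :: nat
      using that by presburger
    \<comment> \<open>Both \<open>t\<close> and \<open>m\<close> are 2 modulo 4. Multiples of 4 are
      added on both sides because subtraction of naturals would truncate.\<close>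
    have "n + t + 4 * (m div 4) = n + m + 4 * (t div 4)"
      using mod2[OF even_t assms(1)] mod2[OF assms(2,3)]
        div_mult_mod_eq[of t 4] div_mult_mod_eq[of m 4] by linarith
    thus ?thesis
      using artin_add4[of "n + t" "m div 4"] artin_add4[of "n + m" "t div 4"] by (simp only:)
  qed
  ultimately show ?thesis by simp
qed

lemma artin_shift_sum_2:
  assumes "\<not> 4 dvd t" "even m" "\<not> 4 dvd m"
  shows "artin (shift_sum m n) = 1"
  by (simp add: shift_sum_def artin_add artin_T_add2[OF assms])

text \<open>Two shifts by \<open>m\<close> move the index by \<open>2 * m\<close>, which is 2 modulo
  4. So after one shift by \<open>m\<close> the old first term reappears as the second, increased by
  1.\<close>

lemma artin_shift_sum_odd:
  assumes "\<not> 4 dvd t" "odd m"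
  shows "artin (shift_sum m n) = 0 \<or> artin (shift_sum m n) = 1" and "artin (shift_sum m (n + 1)) = artin (shift_sum m n) + 1"
proof -
  have "artin (artin (shift_sum m n)) = 0" for n
    using artin_artin[OF assms(1)] by (simp add: shift_sum_def artin_add)
  thus *: "artin (shift_sum m n) = 0 \<or> artin (shift_sum m n) = 1"
    by (simp add: artin_eq_0_iff)
  have "even (2 * m)" "\<not> 4 dvd 2 * m" using assms(2) by presburger+
  from artin_T_add2[OF assms(1) this] have T_m_m: "artin (T (n + m + m)) = artin (T n) + 1" for n
    by (simp only: mult_2 add.assoc)
  have *: "artin (shift_sum m (n + m)) = artin (shift_sum m n) + 1" for n
    using T_m_m[of n] by (simp add: shift_sum_def artin_add)
  \<comment> \<open>Under a shift by 2 both summands gain 1. The value thus has period 2, and the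
    odd shift \<open>m\<close> can be traded for the shift 1.\<close>
  have 2: "artin (shift_sum m (n + 2 * k)) = artin (shift_sum m n)" for k n
  proof (induction k)
    case (Suc k)
    have "artin (T (n + 2)) = artin (T n) + 1" for n
      by (rule artin_T_add2) (use assms in auto)
    from this[of "n + 2 * k"] this[of "n + 2 * k + m"] Suc show ?case
      by (simp add: shift_sum_def artin_add algebra_simps)
  qed simp
  from assms(2) obtain k where "m = 2 * k + 1" by (elim oddE)
  thus "artin (shift_sum m (n + 1)) = artin (shift_sum m n) + 1"
    using *[of n] 2[of "n + 1" k] by (simp add: algebra_simps)
qed

text \<open>As \<open>n\<close> varies, the Artin-Schreier value is constantly 0, constantly 1, or
  alternates from each \<open>n\<close> to the next.\<close>

lemma card_artin_shift_sum:
  assumes "\<delta> = 0 \<or> \<delta> = 1"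
  shows "2 * card {n. n < M \<and> artin (shift_sum m n) = \<delta>} =
    (if 4 dvd t \<or> 4 dvd m then (if \<delta> = 0 then 2 * M else 0)
     else if even m then (if \<delta> = 1 then 2 * M else 0) else M)"
proof -
  consider "4 dvd t \<or> 4 dvd m" | "\<not> 4 dvd t" "even m" "\<not> 4 dvd m" | "\<not> 4 dvd t" "odd m"
    by blast
  thus ?thesis
  proof cases
    case 1
    hence "artin (shift_sum m n) = 0" for n using artin_shift_sum_quartic artin_shift_sum_0 by blast
    thus ?thesis using 1 by auto
  next
    case 2
    thus ?thesis by (auto simp: artin_shift_sum_2)
  next
    case 3
    have "\<not> 4 dvd m" using 3(2) by auto
    have "artin (shift_sum m (n + 1)) = \<delta> \<longleftrightarrow> artin (shift_sum m n) \<noteq> \<delta>" for n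
      using artin_shift_sum_odd[OF 3, of n] assms by auto
    hence "2 * card {n. n < M \<and> artin (shift_sum m n) = \<delta>} = M"
      by (intro card_half_period[where a = 1]) (simp_all add: shift_sum_period)
    thus ?thesis using 3 \<open>\<not> 4 dvd m\<close> by simp
  qed
qed

lemma artin_shift_sum_cases: "artin (shift_sum m n) = 0 \<or> artin (shift_sum m n) = 1"
proof -
  consider "4 dvd t" | "4 dvd m" | "\<not> 4 dvd t" "even m" "\<not> 4 dvd m" | "\<not> 4 dvd t" "odd m"
    by blast
  thus ?thesis
    by cases (simp_all add: artin_shift_sum_quartic artin_shift_sum_0 artin_shift_sum_2 artin_shift_sum_odd(1))
qed

end

text \<open>Below, \<open>m\<close> becomes the index of \<open>p\<close> modulo \<open>q\<close>.\<close>

lemma card_coincidences: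
  assumes "octic_sums T t M" and "octic_sums T' t' M'"
  shows "4 * card {(n, l). n < M' \<and> l < M \<and> T' n + T' (n + m) = T l} =
    (if 8 dvd t \<and> (4 dvd t' \<or> 4 dvd m) then 2
     else if 4 dvd t \<and> \<not> 8 dvd t \<and> \<not> 4 dvd t' \<and> even m \<and> \<not> 4 dvd m then 2
     else if 4 dvd t \<and> \<not> 4 dvd t' \<and> odd m then 1 else 0) * M * M'"
proof -
  interpret p: octic_sums T t M by fact
  interpret q: octic_sums T' t' M' by fact
  have "{(n, l). n < M' \<and> l < M \<and> T' n + T' (n + m) = T l}
      = (SIGMA n:{..<M'}. {l. l < M \<and> T l = q.shift_sum m n})"
    by (auto simp: q.shift_sum_def)
  hence card: "card {(n, l). n < M' \<and> l < M \<and> T' n + T' (n + m) = T l}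
      = (\<Sum>n<M'. card {l. l < M \<and> T l = q.shift_sum m n})" by simp
  \<comment> \<open>For fixed \<open>n\<close>, half of the \<open>l\<close> match if the
    Artin-Schreier values agree, and none otherwise. This leaves a count over \<open>n\<close>
    alone.\<close>
  have half: "4 * (\<Sum>n<M'. card {l. l < M \<and> T l = q.shift_sum m n})
      = M * (2 * card {n. n < M' \<and> artin (q.shift_sum m n) = \<delta>})" if "\<And>i. artin (T i) = \<delta>" for \<delta>
  proof -
    have "2 * (\<Sum>n<M'. card {l. l < M \<and> T l = q.shift_sum m n})
        = (\<Sum>n<M'. if artin (q.shift_sum m n) = \<delta> then M else 0)"
      by (simp only: sum_distrib_left p.card_eq[OF that])
    also have "\<dots> = M * card {n. n < M' \<and> artin (q.shift_sum m n) = \<delta>}"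
      by (simp add: sum.If_cases lessThan_def Collect_conj_eq)
    finally show ?thesis by simp
  qed
  have card0: "2 * card {n. n < M' \<and> artin (q.shift_sum m n) = 0} =
      (if 4 dvd t' \<or> 4 dvd m then 2 * M' else if even m then 0 else M')"
    by (subst q.card_artin_shift_sum) auto
  have card1: "2 * card {n. n < M' \<and> artin (q.shift_sum m n) = 1} =
      (if 4 dvd t' \<or> 4 dvd m then 0 else if even m then 2 * M' else M')"
    by (subst q.card_artin_shift_sum) auto
  have odd_m: "\<not> 4 dvd m" if "odd m"
    using that dvd_trans[of 2 4 m] by auto
  \<comment> \<open>The Artin-Schreier value of \<open>T l\<close> is 0, 1, or outside GF(2),
    respectively. In the last case nothing matches, because that of a \<open>q.shift_sum\<close>
    lies in GF(2).\<close>
  consider "8 dvd t" "4 dvd t" | "4 dvd t" "\<not> 8 dvd t" | "\<not> 4 dvd t" "\<not> 8 dvd t"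
    using dvd_trans[of 4 8 t] by auto
  thus ?thesis
  proof cases
    case 1
    show ?thesis unfolding card half[OF p.artin_octic[OF 1(1)]] card0
      using 1 odd_m by simp
  next
    case 2
    show ?thesis unfolding card half[OF p.artin_quartic[OF 2]] card1
      using 2 odd_m by simp
  next
    case 3
    show ?thesis unfolding card
      using p.card_eq_0[OF 3(1) q.artin_shift_sum_cases] 3 by simp
  qed
qed

subsection \<open>Octic sums at roots of unity\<close>

lemma root_of_unity_power_cong:
  fixes x :: "'a :: monoid_mult"
  assumes "x ^ n = 1" "[i = j] (mod n)"
  shows "x ^ i = x ^ j"
proof -
  have "x ^ k = x ^ (k mod n)" for k
  proof -
    have "x ^ k = x ^ (n * (k div n) + k mod n)" by simp
    thus ?thesis by (simp only: power_add power_mult assms(1) power_one mult_1)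
  qed
  thus ?thesis using assms(2) by (metis cong_def)
qed

lemma power_root_of_unity:
  fixes x :: "'a :: monoid_mult"
  assumes "x ^ n = 1" shows "(x ^ i) ^ n = 1"
  using assms by (metis mult.commute power_mult power_one)

lemma sum_roots_of_unity:
  fixes x :: "'a :: field"
  assumes "x ^ n = 1" "x \<noteq> 1"
  shows "(\<Sum>i<n. x ^ i) = 0"
  using assms power_diff_1_eq[of x n] by auto

text \<open>An exponent prime to \<open>p\<close> is invertible modulo \<open>p\<close>, so
  \<open>x\<close> is itself a power of \<open>x ^ k\<close>.\<close>

lemma prime_order_power_eq_1_iff:
  fixes x :: "'a :: field"
  assumes "prime p" "x ^ p = 1" "x \<noteq> 1"
  shows "x ^ k = 1 \<longleftrightarrow> p dvd k"
proof
  assume "p dvd k"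
  thus "x ^ k = 1" using root_of_unity_power_cong[OF assms(2), of k 0] by (simp add: cong_0_iff)
next
  assume "x ^ k = 1"
  show "p dvd k"
  proof (rule ccontr)
    assume "\<not> p dvd k"
    hence "coprime k p" using assms(1) by (metis prime_imp_coprime coprime_commute)
    then obtain l where "[k * l = 1] (mod p)" using cong_solve_coprime_nat[of k p] by auto
    hence "x ^ (k * l) = x ^ 1" by (rule root_of_unity_power_cong[OF assms(2)])
    hence "x = (x ^ k) ^ l" by (simp add: power_mult)
    thus False using \<open>x ^ k = 1\<close> assms(3) by simp
  qed
qed

text \<open>Any zero of 1 + X + ... + X^(n-1) serves: at 1 this polynomial has the value
  \<open>n\<close>, which is odd and so nonzero.\<close>

lemma ex_root_of_unity:
  assumes "odd n" "n > 1"
  obtains x :: gf2_closure where "x ^ n = 1" "x \<noteq> 1"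
proof -
  define P :: "gf2_closure poly" where "P = (\<Sum>i<n. monom 1 i)"
  have "coeff P (n - 1) = 1"
    using assms by (simp add: P_def coeff_sum)
  hence "degree P > 0"
    using le_degree[of P "n - 1"] assms(2) by simp
  then obtain x where "poly P x = 0" using alg_closed_imp_poly_has_root by blast
  hence *: "(\<Sum>i<n. x ^ i) = 0" by (simp add: P_def poly_sum poly_monom)
  have "x ^ n = 1" using power_diff_1_eq[of x n] * by simp
  moreover have "x \<noteq> 1" using * assms by (auto simp: of_nat_eq_0_iff_even)
  ultimately show ?thesis by (rule that)
qed

lemma inj_on_power_root_of_unity:
  fixes x :: "'a :: field"
  assumes "prime p" "x ^ p = 1" "x \<noteq> 1"
  shows "inj_on (\<lambda>i. x ^ i) {..<p}"
proof (rule linorder_inj_onI)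
  fix i j assume ij: "i < j" "i \<in> {..<p}" "j \<in> {..<p}"
  show "x ^ i \<noteq> x ^ j"
  proof
    assume "x ^ i = x ^ j"
    also have "x ^ j = x ^ i * x ^ (j - i)" using ij by (simp flip: power_add)
    finally have "x ^ (j - i) = 1"
      using assms prime_gt_0_nat[of p] by (cases "x = 0") (auto simp: power_0_left)
    hence "p dvd j - i" using prime_order_power_eq_1_iff[OF assms] by simp
    thus False using ij by (auto dest: dvd_imp_le)
  qed
qed auto

text \<open>The \<open>p\<close> distinct powers of \<open>x\<close> exhaust the at most
  \<open>p\<close> zeros of X^p - 1.\<close>

lemma roots_of_unity_eq_powers:
  fixes x :: "'a :: field"
  assumes "prime p" "x ^ p = 1" "x \<noteq> 1"
  shows "{y. y ^ p = 1} = (\<lambda>i. x ^ i) ` {..<p}"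
proof (rule sym, rule card_seteq)
  have nz: "monom 1 p - 1 \<noteq> (0 :: 'a poly)"
  proof
    assume "monom 1 p - 1 = (0 :: 'a poly)"
    hence "degree (monom (1 :: 'a) p) = 0" by simp
    thus False using prime_gt_0_nat[OF assms(1)] by (simp add: degree_monom_eq)
  qed
  have roots: "{y. poly (monom 1 p - 1) y = 0} = {y :: 'a. y ^ p = 1}"
    by (simp add: poly_monom)
  show "finite {y :: 'a. y ^ p = 1}"
    using poly_roots_finite[OF nz] unfolding roots .
  have "card {y :: 'a. y ^ p = 1} \<le> degree (monom 1 p - 1 :: 'a poly)"
    using card_poly_roots_bound[OF nz] unfolding roots .
  also have "\<dots> \<le> p" by (rule degree_diff_le) (simp_all add: degree_monom_le)
  also have "p = card ((\<lambda>i. x ^ i) ` {..<p})"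
    using inj_on_power_root_of_unity[OF assms] by (simp add: card_image)
  finally show "card {y :: 'a. y ^ p = 1} \<le> card ((\<lambda>i. x ^ i) ` {..<p})" .
  show "(\<lambda>i. x ^ i) ` {..<p} \<subseteq> {y. y ^ p = 1}"
    using power_root_of_unity[OF assms(2)] by auto
qed

lemma bij_betw_roots_of_unity_mult:
  fixes p q :: nat
  assumes "coprime p q"
  shows "bij_betw (\<lambda>(u, v). u * v) ({u. u ^ p = 1} \<times> {v. v ^ q = 1}) {x :: 'a :: field. x ^ (p * q) = 1}"
proof -
  \<comment> \<open>The exponents \<open>a\<close> and \<open>b\<close> are the Chinese remainder
    idempotents; they extract the two factors of a root of unity.\<close>
  obtain a where a: "[a = 1] (mod p)" "[a = 0] (mod q)"
    using binary_chinese_remainder_nat[OF assms, of 1 0] by blast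
  obtain b where b: "[b = 0] (mod p)" "[b = 1] (mod q)"
    using binary_chinese_remainder_nat[OF assms, of 0 1] by blast
  have ab: "[a + b = 1] (mod p * q)"
    using cong_add[OF a(1) b(1)] cong_add[OF a(2) b(2)] assms by (simp add: coprime_cong_mult_nat)
  show ?thesis
  proof (rule bij_betw_byWitness[where f' = "\<lambda>x. (x ^ a, x ^ b)"]; safe)
    fix u v :: 'a assume u: "u ^ p = 1" and v: "v ^ q = 1"
    show "(u * v) ^ a = u"
      using root_of_unity_power_cong[OF u a(1)] root_of_unity_power_cong[OF v a(2)]
      by (simp add: power_mult_distrib)
    show "(u * v) ^ b = v"
      using root_of_unity_power_cong[OF u b(1)] root_of_unity_power_cong[OF v b(2)]
      by (simp add: power_mult_distrib)
    have "(u * v) ^ (p * q) = (u ^ p) ^ q * (v ^ q) ^ p"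
      by (simp add: power_mult_distrib power_mult[symmetric] mult.commute)
    thus "(u * v) ^ (p * q) = 1" by (simp add: u v)
  next
    fix x :: 'a assume x: "x ^ (p * q) = 1"
    show "x ^ a * x ^ b = x"
      using root_of_unity_power_cong[OF x ab] by (simp add: power_add)
    have "[a * p = 0] (mod p * q)"
      using a(2) by (auto simp: cong_0_iff)
    from root_of_unity_power_cong[OF x this] show "(x ^ a) ^ p = 1" by (simp add: power_mult)
    have "[b * q = 0] (mod p * q)"
      using b(1) by (auto simp: cong_0_iff)
    from root_of_unity_power_cong[OF x this] show "(x ^ b) ^ q = 1" by (simp add: power_mult)
  qed
qed

section \<open>Indices with respect to a primitive root\<close>

locale primroot =
  fixes p g :: nat
  assumes prime_p: "prime p" and primroot: "residue_primroot p g" and dvd8: "8 dvd p - 1"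
begin

lemma p_gt_1: "p > 1"
  using prime_p prime_gt_1_nat by blast

lemma p_ge_9: "p \<ge> 9"
  using dvd8 p_gt_1 by (auto dest: dvd_imp_le)

lemma coprime_p_g: "coprime p g" and ord_g: "ord p g = p - 1"
  using primroot prime_p by (auto simp: residue_primroot_def totient_prime)

lemma odd_p: "odd p"
  using dvd8 p_gt_1 by presburger

lemma power_cong_iff: "[g ^ i = g ^ j] (mod p) \<longleftrightarrow> [i = j] (mod p - 1)"
  using order_divides_expdiff[OF coprime_p_g] by (simp add: ord_g)

lemma bij_betw_power: "bij_betw (\<lambda>i. g ^ i mod p) {..<p - 1} {1..<p}"
proof -
  have "totatives p = {1..<p}"
    using prime_p p_gt_1
    by (auto simp: totatives_def coprime_commute[of _ p] prime_nat_iff'' intro!: prime_imp_coprime_nat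
             dest: dvd_imp_le intro: ccontr)
  thus ?thesis
    using residue_primroot_is_generator[OF p_gt_1 primroot] prime_p by (simp add: totient_prime)
qed

lemma coprime_power: "coprime p (g ^ i)"
  using coprime_p_g by simp

lemma ex_index:
  assumes "coprime p a"
  obtains i where "i < p - 1" "[a = g ^ i] (mod p)"
proof -
  have "\<not> p dvd a" using assms p_gt_1 by auto
  hence "a mod p \<in> {1..<p}" using p_gt_1 by (auto simp: Suc_le_eq dvd_eq_mod_eq_0)
  then obtain i where "i \<in> {..<p - 1}" "a mod p = g ^ i mod p"
    using bij_betw_imp_surj_on[OF bij_betw_power] by blast
  thus ?thesis using that by (simp add: cong_def)
qed

text \<open>The index of a \<open>k\<close>-th power is a multiple of \<open>k\<close> modulo
  \<open>p - 1\<close>, and as \<open>k\<close> divides \<open>p - 1\<close>, divisibility by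
  \<open>k\<close> is the same for all representatives of an index.\<close>

lemma power_residue_iff_dvd:
  assumes "k dvd p - 1" "k > 0" "[a = g ^ t] (mod p)"
  shows "power_residue k (int a) p \<longleftrightarrow> k dvd t"
proof
  assume "power_residue k (int a) p"
  then obtain u :: int where u: "[u ^ k = int a] (mod int p)"
    by (auto simp: power_residue_def)
  define w where "w = nat (u mod int p)"
  have w: "[u = int w] (mod int p)" using p_gt_1 by (simp add: w_def cong_def)
  have "[int (w ^ k) = int a] (mod int p)"
    using cong_pow[OF w, of k] u by (metis cong_sym cong_trans of_nat_power)
  hence wk: "[w ^ k = g ^ t] (mod p)"
    using assms(3) by (meson cong_int_iff cong_trans)
  hence "coprime p (w ^ k)" using coprime_power cong_imp_coprime cong_sym by (metis coprime_commute)
  hence "coprime p w" using \<open>k > 0\<close> by simp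
  then obtain i where i: "[w = g ^ i] (mod p)" by (rule ex_index)
  have "[g ^ (i * k) = g ^ t] (mod p)"
    using cong_pow[OF i, of k] wk by (metis cong_sym cong_trans power_mult)
  hence "[i * k = t] (mod p - 1)" by (simp add: power_cong_iff)
  hence "[i * k = t] (mod k)" using assms(1) by (rule cong_dvd_modulus_nat)
  thus "k dvd t" using cong_dvd_iff by (metis dvd_triv_right)
next
  assume "k dvd t"
  then obtain j where t: "t = k * j" by blast
  have "[int ((g ^ j) ^ k) = int a] (mod int p)"
    using assms(3) by (simp only: cong_int_iff t power_mult[symmetric] mult.commute[of j] cong_sym_eq)
  moreover have "\<not> [int a = 0] (mod int p)"
  proof
    assume "[int a = 0] (mod int p)"
    hence "p dvd a" by (simp add: cong_0_iff)
    hence "p dvd g ^ t" using assms(3) cong_dvd_iff by blast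
    thus False using coprime_power[of t] p_gt_1 coprime_absorb_left[of p "g ^ t"] by simp
  qed
  ultimately show "power_residue k (int a) p"
    unfolding power_residue_def by (metis of_nat_power)
qed

text \<open>An element \<open>z\<close> of order 8 satisfies z^4 = -1, hence z^2 + z^(-2) = 0 and (z
  + z^(-1))^2 = 2; here \<open>z ^ 7\<close> is the inverse of \<open>z\<close>. This will make the
  index of 2 even.\<close>

lemma power_residue_2_2: "power_residue 2 2 p"
proof -
  define z where "z = int g ^ ((p - 1) div 8)"
  have z_pow: "z ^ k = int (g ^ ((p - 1) div 8 * k))" for k
    by (simp add: z_def power_mult)
  have "[z ^ 8 = 1] (mod int p)"
    using power_cong_iff[of "(p - 1) div 8 * 8" 0] dvd8 unfolding z_pow
    by (metis cong_int_iff cong_mult_self_right cong_0_iff dvd_div_mult_self dvd_refl of_nat_1 power_0)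
  moreover have "\<not> [z ^ 4 = 1] (mod int p)"
  proof
    assume "[z ^ 4 = 1] (mod int p)"
    hence "[g ^ ((p - 1) div 8 * 4) = g ^ 0] (mod p)"
      unfolding z_pow by (metis cong_int_iff of_nat_1 power_0)
    hence "p - 1 dvd (p - 1) div 8 * 4" by (simp only: power_cong_iff cong_0_iff)
    thus False using dvd8 p_gt_1 by (auto elim!: dvdE dest!: dvd_imp_le)
  qed
  moreover have "z ^ 8 - 1 = (z ^ 4 - 1) * (z ^ 4 + 1)" by (simp add: algebra_simps flip: power_add)
  ultimately have "int p dvd z ^ 4 + 1"
    using prime_p by (metis cong_iff_dvd_diff prime_dvd_mult_iff prime_nat_int_transfer)
  moreover have "(z + z ^ 7)\<^sup>2 - 2 = (z ^ 4 + 1) * (z\<^sup>2 * (z ^ 8 - z ^ 4 + 1) + 2 * (z ^ 4 - 1))"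
    by (simp add: eval_nat_numeral algebra_simps)
  ultimately have "[(z + z ^ 7)\<^sup>2 = 2] (mod int p)"
    by (simp add: cong_iff_dvd_diff)
  moreover have "\<not> [2 = 0] (mod int p)"
    using p_ge_9 by (auto simp: cong_0_iff dest: zdvd_imp_le)
  ultimately show ?thesis unfolding power_residue_def by blast
qed

section \<open>Octic sums attached to a prime\<close>

definition upper_class :: "nat \<Rightarrow> bool" where
  "upper_class y \<longleftrightarrow> (\<exists>k. [y = g ^ k] (mod p) \<and> 4 \<le> k mod 8)"

text \<open>Two exponents for the same residue agree modulo \<open>p - 1\<close>, hence modulo 8, so
  every witness in \<open>upper_class\<close> gives the same verdict.\<close>

lemma upper_class_power_iff: "upper_class (g ^ k mod p) \<longleftrightarrow> 4 \<le> k mod 8"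
proof
  assume "upper_class (g ^ k mod p)"
  then obtain l where l: "[g ^ k = g ^ l] (mod p)" "4 \<le> l mod 8"
    by (auto simp: upper_class_def)
  hence "[k = l] (mod 8)"
    using dvd8 by (meson cong_dvd_modulus_nat power_cong_iff)
  thus "4 \<le> k mod 8" using l(2) by (simp add: cong_def)
next
  assume "4 \<le> k mod 8"
  thus "upper_class (g ^ k mod p)" unfolding upper_class_def by (intro exI[of _ k]) simp
qed

lemma upper_class_cong: "[x = y] (mod p) \<Longrightarrow> upper_class x \<longleftrightarrow> upper_class y"
  unfolding upper_class_def by (meson cong_sym cong_trans)

text \<open>The sum written T_p, or T_q for the other prime, in the overview.\<close>

definition upper_sum :: "gf2_closure \<Rightarrow> gf2_closure" where
  "upper_sum u = (\<Sum>y\<in>{1..<p}. of_bool (upper_class y) * u ^ y)"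

lemma upper_sum_eq:
  assumes "u ^ p = 1"
  shows "upper_sum u = (\<Sum>k<p - 1. of_bool (4 \<le> k mod 8) * u ^ (g ^ k))"
proof -
  have "upper_sum u = (\<Sum>k<p - 1. of_bool (upper_class (g ^ k mod p)) * u ^ (g ^ k mod p))"
    unfolding upper_sum_def by (rule sum.reindex_bij_betw[OF bij_betw_power, symmetric])
  also have "\<dots> = (\<Sum>k<p - 1. of_bool (4 \<le> k mod 8) * u ^ (g ^ k))"
    by (intro sum.cong refl arg_cong2[of _ _ _ _ "(*)"])
       (simp_all add: upper_class_power_iff root_of_unity_power_cong[OF assms, of "_ mod p"])
  finally show ?thesis .
qed

lemma sum_nonzero_powers:
  assumes "u ^ p = 1"
  shows "(\<Sum>y\<in>{1..<p}. u ^ y) = (if u = 1 then 0 else (1 :: gf2_closure))"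
proof (cases "u = 1")
  case True
  thus ?thesis using odd_p p_gt_1 by (simp add: of_nat_odd)
next
  case False
  have "{..<p} = insert 0 {1..<p}" using p_gt_1 by auto
  hence "1 + (\<Sum>y\<in>{1..<p}. u ^ y) = 0"
    using sum_roots_of_unity[OF assms False] by simp
  thus ?thesis using False by (simp add: add_eq_0_iff_eq)
qed

text \<open>Exactly (p-1)/2 exponents contribute a 1, and this number is divisible by 4.\<close>

lemma upper_sum_1: "upper_sum 1 = 0"
proof -
  have "2 * card {k. k < p - 1 \<and> 4 \<le> k mod 8} = p - 1"
    using dvd8 by (intro card_half_period[where a = 4]) (auto elim!: dvdE, presburger+)
  hence "even (card {k. k < p - 1 \<and> 4 \<le> k mod 8})"
    using dvd8 by presburger
  moreover have "upper_sum 1 = of_nat (card {k. k < p - 1 \<and> 4 \<le> k mod 8})"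
    by (subst upper_sum_eq) (simp_all add: lessThan_def Collect_conj_eq)
  ultimately show ?thesis by (simp only: of_nat_eq_0_iff_even)
qed

lemma bij_betw_nontrivial_roots:
  fixes z :: "'a :: field"
  assumes "z ^ p = 1" "z \<noteq> 1"
  shows "bij_betw (\<lambda>n. z ^ (g ^ n)) {..<p - 1} ({u. u ^ p = 1} - {1})"
proof -
  have "bij_betw (\<lambda>i. z ^ i) {..<p} {u. u ^ p = 1}"
    using inj_on_power_root_of_unity[OF prime_p assms] roots_of_unity_eq_powers[OF prime_p assms]
    by (simp add: bij_betw_def)
  hence "bij_betw (\<lambda>i. z ^ i) ({..<p} - {0}) ({u. u ^ p = 1} - {1})"
    using p_gt_1 by (intro bij_betw_DiffI) (auto simp: bij_betw_def)
  moreover have "{..<p} - {0} = {1..<p}" by auto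
  ultimately have "bij_betw ((\<lambda>i. z ^ i) \<circ> (\<lambda>n. g ^ n mod p)) {..<p - 1} ({u. u ^ p = 1} - {1})"
    using bij_betw_power by (intro bij_betw_trans) auto
  thus ?thesis
    by (rule bij_betw_cong[THEN iffD1, rotated])
       (simp add: root_of_unity_power_cong[OF assms(1), of "_ mod p"])
qed

text \<open>Shifting the index by 4 interchanges the classes 0, ..., 3 and 4, ..., 7, and all
  classes together sum to 1. Squaring is raising to the power \<open>g ^ t\<close>, that is, a shift
  by \<open>t\<close>.\<close>

lemma octic_sums_upper_sum:
  assumes "z ^ p = 1" "z \<noteq> 1" and t: "[2 = g ^ t] (mod p)"
  shows "octic_sums (\<lambda>n. upper_sum (z ^ (g ^ n))) t (p - 1)"
proof -
  define e where "e n = z ^ (g ^ n)" for n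
  have e_root: "e n ^ p = 1" for n
    unfolding e_def using assms(1) by (rule power_root_of_unity)
  have e_cong: "e i = e j" if "[i = j] (mod p - 1)" for i j
    using that unfolding e_def by (intro root_of_unity_power_cong[OF assms(1)]) (simp add: power_cong_iff)
  have e_add: "e n ^ (g ^ k) = e (n + k)" for n k
    by (simp add: e_def power_add power_mult)
  have upper_sum_e: "upper_sum (e n) = (\<Sum>k<p - 1. of_bool (4 \<le> k mod 8) * e (n + k))" for n
    by (subst upper_sum_eq) (simp_all add: e_root e_add)
  have e_per: "e (n + k + (p - 1)) = e (n + k)" for n k
    by (rule e_cong) (simp add: cong_def)
  have sum_e: "(\<Sum>k<p - 1. e (n + k)) = 1" for n
  proof -
    have "(\<Sum>k<p - 1. e (n + k)) = (\<Sum>k<p - 1. e k)"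
      using sum_shift_period[of e "p - 1" n] e_per[of 0] by (simp add: add.commute)
    also have "\<dots> = (\<Sum>y\<in>{1..<p}. z ^ y)"
      unfolding sum.reindex_bij_betw[OF bij_betw_power, symmetric] e_def
      by (intro sum.cong refl root_of_unity_power_cong[OF assms(1)]) (simp add: cong_def)
    finally show ?thesis using sum_nonzero_powers[OF assms(1)] assms(2) by simp
  qed
  have add4: "upper_sum (z ^ (g ^ (i + 4))) = upper_sum (z ^ (g ^ i)) + 1" for i
  proof -
    from dvd8 obtain m where m: "p - 1 = 8 * m" ..
    have mod8: "(k + (p - 1) + 4) mod 8 = (k + 4) mod 8" for k
      unfolding m by presburger
    \<comment> \<open>Adding 8 inside the class condition makes the summand a function of
      \<open>k + 4\<close>, so that the periodic shift applies.\<close>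
    have "upper_sum (e (i + 4)) = (\<Sum>k<p - 1. of_bool (4 \<le> (k + 4 + 4) mod 8) * e (i + (k + 4)))"
      unfolding upper_sum_e by (intro sum.cong refl) (simp add: add_ac)
    also have "\<dots> = (\<Sum>k<p - 1. of_bool (4 \<le> (k + 4) mod 8) * e (i + k))"
      by (rule sum_shift_period[where F = "\<lambda>k. of_bool (4 \<le> (k + 4) mod 8) * e (i + k)"])
         (simp only: mod8 add.assoc[symmetric] e_per)
    finally have "upper_sum (e (i + 4)) + upper_sum (e i)
        = (\<Sum>k<p - 1. (of_bool (4 \<le> (k + 4) mod 8) + of_bool (4 \<le> k mod 8)) * e (i + k))"
      by (simp only: upper_sum_e sum.distrib[symmetric] distrib_right)
    also have "\<dots> = (\<Sum>k<p - 1. e (i + k))"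
    proof (intro sum.cong refl)
      fix k :: nat
      have "4 \<le> (k + 4) mod 8 \<longleftrightarrow> \<not> 4 \<le> k mod 8" by presburger
      thus "(of_bool (4 \<le> (k + 4) mod 8) + of_bool (4 \<le> k mod 8)) * e (i + k) = e (i + k)"
        by simp
    qed
    finally have "upper_sum (e (i + 4)) + upper_sum (e i) = 1" by (simp only: sum_e)
    hence "upper_sum (e (i + 4)) = 1 + upper_sum (e i)" by (rule add_eq_iff[THEN iffD1])
    thus ?thesis by (simp add: e_def add.commute)
  qed
  have square: "(upper_sum (z ^ (g ^ i)))\<^sup>2 = upper_sum (z ^ (g ^ (i + t)))" for i
  proof -
    have "(e n)\<^sup>2 = e (n + t)" for n
    proof -
      have "(e n)\<^sup>2 = e n ^ (g ^ t)" using t by (rule root_of_unity_power_cong[OF e_root])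
      thus ?thesis by (simp add: e_add)
    qed
    moreover have "(of_bool b)\<^sup>2 = (of_bool b :: gf2_closure)" for b by simp
    ultimately have "(upper_sum (e i))\<^sup>2 = upper_sum (e (i + t))"
      by (simp only: upper_sum_e square_sum power_mult_distrib add_ac)
    thus ?thesis by (simp add: e_def)
  qed
  have even: "even t"
    using power_residue_iff_dvd[of 2 2 t] power_residue_2_2 t dvd8 dvd_trans[of 2 8 "p - 1"] by simp
  have period: "upper_sum (z ^ (g ^ (i + (p - 1)))) = upper_sum (z ^ (g ^ i))" for i
  proof -
    have "e (i + (p - 1)) = e i" by (rule e_cong) (simp add: cong_def)
    thus ?thesis by (simp only: e_def)
  qed
  from add4 square even period show ?thesis by (rule octic_sums.intro)
qed

end

section \<open>Zeros of octic sums and sums over multiples\<close>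

lemma card_filter_bij_betw:
  assumes "bij_betw f A B"
  shows "card {b \<in> B. P b} = card {a \<in> A. P (f a)}"
proof (rule bij_betw_same_card[symmetric])
  have "inj_on f {a \<in> A. P (f a)}"
    using assms by (auto simp: bij_betw_def inj_on_def)
  moreover have "f ` {a \<in> A. P (f a)} = {b \<in> B. P b}"
    using assms by (auto simp: bij_betw_def)
  ultimately show "bij_betw f {a \<in> A. P (f a)} {b \<in> B. P b}" by (simp add: bij_betw_def)
qed

lemma nontrivial_root_power:
  fixes z :: "'a :: field"
  assumes "prime p" "z ^ p = 1" "z \<noteq> 1" "coprime p k"
  shows "(z ^ k) ^ p = 1" "z ^ k \<noteq> 1"
proof -
  show "(z ^ k) ^ p = 1" using assms(2) by (rule power_root_of_unity)
  have "\<not> p dvd k" using assms(1,4) by (metis coprime_absorb_left not_prime_unit)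
  thus "z ^ k \<noteq> 1" using prime_order_power_eq_1_iff[OF assms(1-3)] by simp
qed

context primroot
begin

lemma totatives_p: "totatives p = {1..<p}"
  using bij_betw_imp_surj_on[OF residue_primroot_is_generator[OF p_gt_1 primroot]]
    bij_betw_imp_surj_on[OF bij_betw_power]
  unfolding totient_prime[OF prime_p] by (rule trans[OF sym])

lemma card_roots_of_unity: "card {u :: gf2_closure. u ^ p = 1} = p"
proof -
  obtain z :: gf2_closure where z: "z ^ p = 1" "z \<noteq> 1"
    using ex_root_of_unity[OF odd_p p_gt_1] by blast
  show ?thesis
    unfolding roots_of_unity_eq_powers[OF prime_p z]
    using inj_on_power_root_of_unity[OF prime_p z] by (simp add: card_image)
qed

text \<open>Passing from \<open>u\<close> to \<open>u ^ k\<close> replaces the base root by another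
  nontrivial one, to which \<open>card_zeros\<close> applies. It serves with \<open>k\<close> the
  other prime.\<close>

lemma card_upper_sum_zeros:
  assumes "coprime p k" and t: "[2 = g ^ t] (mod p)"
  shows "2 * card {u. u ^ p = 1 \<and> u \<noteq> 1 \<and> upper_sum (u ^ k) = 0} = (if 8 dvd t then p - 1 else 0)"
proof -
  obtain z :: gf2_closure where z: "z ^ p = 1" "z \<noteq> 1"
    using ex_root_of_unity[OF odd_p p_gt_1] by blast
  note zk = nontrivial_root_power[OF prime_p z assms(1)]
  interpret octic_sums "\<lambda>n. upper_sum ((z ^ k) ^ (g ^ n))" t "p - 1"
    using zk t by (rule octic_sums_upper_sum)
  have "{u. u ^ p = 1 \<and> u \<noteq> 1 \<and> upper_sum (u ^ k) = 0} = {u \<in> {u. u ^ p = 1} - {1}. upper_sum (u ^ k) = 0}"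
    by auto
  also have "card \<dots> = card {n \<in> {..<p - 1}. upper_sum ((z ^ (g ^ n)) ^ k) = 0}"
    by (rule card_filter_bij_betw[OF bij_betw_nontrivial_roots[OF z]])
  also have "\<dots> = card {n. n < p - 1 \<and> upper_sum ((z ^ k) ^ (g ^ n)) = 0}"
    by (simp add: power_mult[symmetric] mult.commute)
  finally show ?thesis using card_zeros by simp
qed

text \<open>The other prime is the parameter \<open>r\<close>, so that one argument covers the
  multiples of \<open>p\<close> and those of \<open>q\<close>.\<close>

lemma mem_DH_P_iff:
  assumes gcd: "gcd (r - 1) (p - 1) = 8" and G: "[G = int g] (mod int p)" and "r > 0"
  shows "(\<exists>j\<in>{4..7}. int i \<in> DH_P r p G j) \<longleftrightarrow> (\<exists>y\<in>{1..<p}. i = r * y \<and> upper_class y)"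
proof -
  have DH: "int i \<in> DH_P r p G j \<longleftrightarrow> (\<exists>t<(p - 1) div 8. i = r * (g ^ (j + 8 * t) mod p))" for j
  proof -
    have "(int r * G ^ n) mod int (r * p) = int (r * (g ^ n mod p))" for n
    proof -
      have "(int r * G ^ n) mod int (r * p) = int r * (G ^ n mod int p)"
        by simp
      also have "G ^ n mod int p = int (g ^ n) mod int p"
        using cong_pow[OF G, of n] by (simp add: cong_def)
      finally show ?thesis by (simp add: of_nat_mod)
    qed
    thus ?thesis unfolding DH_P_def Let_def gcd by (simp only: mem_Collect_eq of_nat_eq_iff) blast
  qed
  show ?thesis
  proof
    assume "\<exists>j\<in>{4..7}. int i \<in> DH_P r p G j"
    then obtain j t where j: "j \<in> {4..7}" and i: "i = r * (g ^ (j + 8 * t) mod p)"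
      unfolding DH by blast
    have "g ^ (j + 8 * t) mod p \<in> {1..<p}"
      using coprime_power[of "j + 8 * t"] p_gt_1 coprime_absorb_left[of p "g ^ (j + 8 * t)"]
      by (auto simp: Suc_le_eq dvd_eq_mod_eq_0)
    moreover have "upper_class (g ^ (j + 8 * t) mod p)"
      unfolding upper_class_power_iff using j by auto
    ultimately show "\<exists>y\<in>{1..<p}. i = r * y \<and> upper_class y" using i by blast
  next
    assume "\<exists>y\<in>{1..<p}. i = r * y \<and> upper_class y"
    then obtain y where y: "y \<in> {1..<p}" "i = r * y" "upper_class y" by blast
    then obtain k where k: "[y = g ^ k] (mod p)" "4 \<le> k mod 8" by (auto simp: upper_class_def)
    define M where "M = (p - 1) div 8"
    have M: "p - 1 = 8 * M" "M > 0" using dvd8 p_gt_1 by (auto simp: M_def)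
    \<comment> \<open>Reducing the quotient modulo \<open>M\<close> brings \<open>t\<close> into its
      range and changes the exponent by a multiple of \<open>8 * M\<close>, which is
      \<open>p - 1\<close>.\<close>
    define j t where "j = k mod 8" and "t = (k div 8) mod M"
    have "[j + 8 * t = j + 8 * (k div 8)] (mod 8 * M)"
      by (intro cong_add cong_refl cong_cmult_leftI) (simp_all add: t_def cong_def)
    hence "[g ^ (j + 8 * t) = g ^ k] (mod p)"
      unfolding power_cong_iff M(1) by (simp add: j_def)
    hence "g ^ (j + 8 * t) mod p = y"
      using k(1) y(1) by (simp add: cong_def)
    moreover have "t < (p - 1) div 8" "j \<in> {4..7}"
      using M k(2) by (auto simp: t_def j_def M_def[symmetric])
    ultimately show "\<exists>j\<in>{4..7}. int i \<in> DH_P r p G j"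
      unfolding DH using y(2) by blast
  qed
qed

lemma sum_multiples:
  fixes x :: gf2_closure
  assumes "r > 0"
  shows "(\<Sum>i<r * p. of_bool (\<exists>y\<in>{1..<p}. i = r * y \<and> upper_class y) * x ^ i) = upper_sum (x ^ r)"
proof -
  have "upper_sum (x ^ r) = (\<Sum>y\<in>{1..<p}. of_bool (\<exists>y'\<in>{1..<p}. r * y = r * y' \<and> upper_class y') * x ^ (r * y))"
    unfolding upper_sum_def using assms by (intro sum.cong refl) (auto simp: power_mult)
  also have "\<dots> = (\<Sum>i\<in>(\<lambda>y. r * y) ` {1..<p}. of_bool (\<exists>y\<in>{1..<p}. i = r * y \<and> upper_class y) * x ^ i)"
    using assms by (subst sum.reindex) (auto simp: inj_on_def)
  also have "\<dots> = (\<Sum>i<r * p. of_bool (\<exists>y\<in>{1..<p}. i = r * y \<and> upper_class y) * x ^ i)"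
    using assms by (intro sum.mono_neutral_left) auto
  finally show ?thesis ..
qed

end

subsection \<open>The Ding-Helleseth sequence\<close>

lemma DH_Q_eq_DH_P: "DH_Q p q = DH_P q p"
  by (intro ext)
     (simp only: DH_Q_def DH_P_def gcd.commute[of "q - 1" "p - 1"] mult.commute[of q p])

text \<open>The naturals \<open>gp\<close> and \<open>gq\<close> represent the integer
  \<open>g\<close> modulo each prime, because indices are taken with natural primitive
  roots.\<close>

locale ding_helleseth = P: primroot p gp + Q: primroot q gq for p gp q gq +
  fixes g f :: int
  assumes gcd_eq_8: "gcd (p - 1) (q - 1) = 8"
    and g_cong_p: "[g = int gp] (mod int p)" and g_cong_q: "[g = int gq] (mod int q)"
    and f_cong_p: "[f = g] (mod int p)" and f_cong_q: "[f = 1] (mod int q)"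
begin

lemma coprime_p_q: "coprime p q"
proof -
  have "p \<noteq> q"
  proof
    assume "p = q"
    hence "p = 9" using gcd_eq_8 by simp
    thus False using P.prime_p by (auto simp: prime_nat_iff dest!: spec[of _ 3])
  qed
  thus ?thesis using P.prime_p Q.prime_p by (simp add: primes_coprime)
qed

lemma D_element_cong:
  "[g ^ n * f ^ v = int (gp ^ (n + v))] (mod int p)" "[g ^ n * f ^ v = int (gq ^ n)] (mod int q)"
proof -
  have "[f = int gp] (mod int p)" using f_cong_p g_cong_p by (rule cong_trans)
  from cong_mult[OF cong_pow[OF g_cong_p, of n] cong_pow[OF this, of v]]
  show "[g ^ n * f ^ v = int (gp ^ (n + v))] (mod int p)" by (simp add: power_add)
  from cong_mult[OF cong_pow[OF g_cong_q, of n] cong_pow[OF f_cong_q, of v]]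
  show "[g ^ n * f ^ v = int (gq ^ n)] (mod int q)" by simp
qed

lemma eq_D_element_iff:
  assumes "i < p * q"
  shows "int i = (g ^ n * f ^ v) mod int (p * q) \<longleftrightarrow> [i = gp ^ (n + v)] (mod p) \<and> [i = gq ^ n] (mod q)"
proof -
  have "int i = (g ^ n * f ^ v) mod int (p * q) \<longleftrightarrow> [int i = g ^ n * f ^ v] (mod int p * int q)"
    using assms by (simp add: cong_def flip: of_nat_mult of_nat_mod)
  also have "\<dots> \<longleftrightarrow> [int i = g ^ n * f ^ v] (mod int p) \<and> [int i = g ^ n * f ^ v] (mod int q)"
    using coprime_p_q coprime_cong_mult[of "int i" "g ^ n * f ^ v" "int p" "int q"]
    by (auto intro: cong_dvd_modulus)
  also have "\<dots> \<longleftrightarrow> [i = gp ^ (n + v)] (mod p) \<and> [i = gq ^ n] (mod q)"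
    using D_element_cong[of n v] by (meson cong_int_iff cong_sym cong_trans)
  finally show ?thesis .
qed

text \<open>The factor \<open>f ^ v\<close> shifts the index modulo \<open>p\<close> by
  \<open>v\<close> and leaves that modulo \<open>q\<close> alone. Running through 0, ..., 7,
  \<open>v\<close> absorbs the difference of the two indices modulo 8, so only the index modulo
  \<open>q\<close> decides the class.\<close>

lemma mem_DH_D_iff:
  assumes i: "i < p * q"
  shows "(\<exists>j\<in>{4..7}. int i \<in> DH_D p q g f j) \<longleftrightarrow> coprime i (p * q) \<and> Q.upper_class i"
proof -
  define A B where "A = (p - 1) div 8" and "B = (q - 1) div 8"
  have A: "p - 1 = 8 * A" "A > 0" using P.dvd8 P.p_gt_1 by (auto simp: A_def)
  have B: "q - 1 = 8 * B" "B > 0" using Q.dvd8 Q.p_gt_1 by (auto simp: B_def)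
  have "8 * gcd A B = 8"
    using gcd_eq_8 unfolding A(1) B(1) gcd_mult_distrib_nat[symmetric] .
  hence "coprime A B" unfolding coprime_iff_gcd_eq_1 by linarith
  have "lcm (p - 1) (q - 1) div 8 = A * B"
    unfolding lcm_nat_def gcd_eq_8 unfolding A(1) B(1) by simp
  hence DH: "int i \<in> DH_D p q g f j \<longleftrightarrow> (\<exists>t v. t < A * B \<and> v < 8 \<and>
      [i = gp ^ (j + 8 * t + v)] (mod p) \<and> [i = gq ^ (j + 8 * t)] (mod q))" for j
    unfolding DH_D_def Let_def gcd_eq_8
    by (simp only: mem_Collect_eq eq_D_element_iff[OF i] mult.assoc) auto
  show ?thesis
  proof
    assume "\<exists>j\<in>{4..7}. int i \<in> DH_D p q g f j"
    then obtain j t v where j: "j \<in> {4..7}"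
      and ip: "[i = gp ^ (j + 8 * t + v)] (mod p)" and iq: "[i = gq ^ (j + 8 * t)] (mod q)"
      unfolding DH by blast
    have "coprime i p"
      by (rule cong_imp_coprime[OF cong_sym[OF ip] P.coprime_power[THEN coprime_commute[THEN iffD1]]])
    moreover have "coprime i q"
      by (rule cong_imp_coprime[OF cong_sym[OF iq] Q.coprime_power[THEN coprime_commute[THEN iffD1]]])
    moreover have "Q.upper_class i"
      unfolding Q.upper_class_def using iq j by (intro exI[of _ "j + 8 * t"]) auto
    ultimately show "coprime i (p * q) \<and> Q.upper_class i" by simp
  next
    assume *: "coprime i (p * q) \<and> Q.upper_class i"
    then obtain k where k: "[i = gq ^ k] (mod q)" "4 \<le> k mod 8" by (auto simp: Q.upper_class_def)
    from * have "coprime p i" by (simp add: coprime_commute)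
    then obtain l0 where l0: "[i = gp ^ l0] (mod p)" by (rule P.ex_index)
    \<comment> \<open>The index modulo \<open>p\<close> is raised by a multiple of
      \<open>p - 1\<close> until it is at least \<open>k\<close>, so that the difference
      \<open>d\<close> is a natural number.\<close>
    define l where "l = l0 + k * (p - 1)"
    have "[l0 = l] (mod p - 1)" by (simp add: l_def cong_def)
    hence l: "[i = gp ^ l] (mod p)" using l0 by (metis P.power_cong_iff cong_trans)
    have "k \<le> l" using mult_le_mono2[of 1 "p - 1" k] P.p_gt_1 unfolding l_def by linarith
    then obtain d where d: "l = k + d" using le_Suc_ex by blast
    define v where "v = d mod 8"
    define j where "j = k mod 8"
    define b where "b = k div 8 + d div 8"
    have jk: "j + 8 * (k div 8) = k" by (simp add: j_def)
    have "v + 8 * (d div 8) = d" by (simp add: v_def)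
    hence lb: "l = j + 8 * b + v"
      using d jk by (simp add: b_def)
    \<comment> \<open>The prime \<open>p\<close> prescribes \<open>t\<close> modulo
      \<open>A\<close>, the prime \<open>q\<close> modulo \<open>B\<close>; the two are coprime
      because the gcd is exactly 8.\<close>
    obtain t where t: "t < A * B" "[t = b] (mod A)" "[t = k div 8] (mod B)"
      using binary_chinese_remainder_unique_nat[OF \<open>coprime A B\<close>, of b "k div 8"] A(2) B(2) by auto
    have "[j + 8 * t + v = l] (mod p - 1)"
      unfolding lb A(1) by (intro cong_add cong_refl cong_cmult_leftI t)
    hence "[i = gp ^ (j + 8 * t + v)] (mod p)"
      using l P.power_cong_iff cong_sym cong_trans by metis
    moreover have "[j + 8 * t = k] (mod q - 1)"
      using cong_add[OF cong_refl[of j] cong_cmult_leftI[OF t(3), of 8]] unfolding B(1) jk .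
    hence "[i = gq ^ (j + 8 * t)] (mod q)"
      using k(1) Q.power_cong_iff cong_sym cong_trans by metis
    moreover have "v < 8" "j \<in> {4..7}" using k(2) by (auto simp: v_def j_def)
    ultimately show "\<exists>j\<in>{4..7}. int i \<in> DH_D p q g f j"
      unfolding DH using t(1) by (intro bexI[of _ j] exI[of _ t] exI[of _ v] conjI)
  qed
qed

lemma DH_sequence_eq:
  assumes "i < p * q"
  shows "DH_sequence p q g f i = of_bool (coprime i (p * q) \<and> Q.upper_class i \<or>
    (\<exists>y\<in>{1..<q}. i = p * y \<and> Q.upper_class y) \<or> (\<exists>y\<in>{1..<p}. i = q * y \<and> P.upper_class y))"
proof -
  have "int i mod int (p * q) = int i" using assms by (simp flip: of_nat_mult of_nat_mod)
  moreover have "{8 div 2..8 - 1} = {4..7 :: nat}" by simp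
  moreover have "p > 0" "q > 0" using P.p_gt_1 Q.p_gt_1 by auto
  ultimately show ?thesis
    using mem_DH_D_iff[OF assms] Q.mem_DH_P_iff[OF gcd_eq_8 g_cong_q, of i]
      P.mem_DH_P_iff[OF gcd_eq_8[unfolded gcd.commute[of "p - 1"]] g_cong_p, of i]
    unfolding DH_sequence_def Let_def gcd_eq_8 DH_Q_eq_DH_P by auto
qed

lemma sum_units:
  fixes u v :: gf2_closure
  assumes "u ^ p = 1" "v ^ q = 1"
  shows "(\<Sum>i<p * q. of_bool (coprime i (p * q) \<and> Q.upper_class i) * (u * v) ^ i)
       = (if u = 1 then 0 else Q.upper_sum v)"
proof -
  have pq: "p * q > 1"
    using one_less_mult[of q p] P.p_gt_1 Q.p_gt_1 by simp
  hence sub: "totatives (p * q) \<subseteq> {..<p * q}"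
    by (auto dest: totatives_less)
  have unit: "i \<in> totatives (p * q)" if "i < p * q" "coprime i (p * q)" for i
  proof -
    have "i \<noteq> 0" using that pq by (intro notI) simp
    thus ?thesis using that by (simp add: totatives_def)
  qed
  have "(\<Sum>i<p * q. of_bool (coprime i (p * q) \<and> Q.upper_class i) * (u * v) ^ i)
      = (\<Sum>i\<in>totatives (p * q). of_bool (coprime i (p * q) \<and> Q.upper_class i) * (u * v) ^ i)"
    by (intro sum.mono_neutral_right sub) (use unit in auto)
  \<comment> \<open>A unit is a pair of nonzero residues and the summand splits accordingly, so the
    sum becomes a product. Its first factor, the sum of the \<open>u ^ a\<close>, is 0 or 1.\<close>
  also have "\<dots> = (\<Sum>i\<in>totatives (p * q). case (i mod p, i mod q) of
      (a, b) \<Rightarrow> u ^ a * (of_bool (Q.upper_class b) * v ^ b))"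
  proof (intro sum.cong refl)
    fix i assume "i \<in> totatives (p * q)"
    hence "coprime i (p * q)" by (simp add: totatives_def)
    moreover have "Q.upper_class (i mod q) \<longleftrightarrow> Q.upper_class i" by (rule Q.upper_class_cong) simp
    moreover have "u ^ (i mod p) = u ^ i" "v ^ (i mod q) = v ^ i"
      by (rule root_of_unity_power_cong, fact, simp)+
    ultimately show "of_bool (coprime i (p * q) \<and> Q.upper_class i) * (u * v) ^ i =
      (case (i mod p, i mod q) of (a, b) \<Rightarrow> u ^ a * (of_bool (Q.upper_class b) * v ^ b))"
      by (simp add: power_mult_distrib)
  qed
  also have "\<dots> = (\<Sum>(a, b)\<in>{1..<p} \<times> {1..<q}. u ^ a * (of_bool (Q.upper_class b) * v ^ b))"
    using sum.reindex_bij_betw[OF bij_betw_totatives[OF P.p_gt_1 Q.p_gt_1 coprime_p_q]]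
    unfolding P.totatives_p Q.totatives_p .
  also have "\<dots> = (\<Sum>a\<in>{1..<p}. u ^ a) * Q.upper_sum v"
    by (simp only: sum.cartesian_product[symmetric] sum_product Q.upper_sum_def)
  also have "\<dots> = (if u = 1 then 0 else Q.upper_sum v)"
    unfolding P.sum_nonzero_powers[OF assms(1)] by simp
  finally show ?thesis .
qed

lemma dft_DH_sequence:
  fixes u v :: gf2_closure
  assumes "u ^ p = 1" "v ^ q = 1"
  shows "dft (p * q) (\<lambda>i. to_ac (DH_sequence p q g f i)) (u * v)
       = (if u = 1 then 0 else Q.upper_sum v) + Q.upper_sum (v ^ p) + P.upper_sum (u ^ q)"
proof -
  have eq: "to_ac (DH_sequence p q g f i) = (of_bool (coprime i (p * q) \<and> Q.upper_class i)
      + of_bool (\<exists>y\<in>{1..<q}. i = p * y \<and> Q.upper_class y)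
      + of_bool (\<exists>y\<in>{1..<p}. i = q * y \<and> P.upper_class y) :: gf2_closure)" if "i < p * q" for i
  proof -
    \<comment> \<open>Units, nonzero multiples of \<open>p\<close> and nonzero multiples of
      \<open>q\<close> are disjoint, so the indicators can be added without cancelling in
      characteristic 2.\<close>
    define a b c where "a \<longleftrightarrow> coprime i (p * q) \<and> Q.upper_class i"
      and "b \<longleftrightarrow> (\<exists>y\<in>{1..<q}. i = p * y \<and> Q.upper_class y)" and "c \<longleftrightarrow> (\<exists>y\<in>{1..<p}. i = q * y \<and> P.upper_class y)"
    note abc = this
    have "\<not> (a \<and> b)" "\<not> (a \<and> c)"
      using P.p_gt_1 Q.p_gt_1 by (auto simp: abc coprime_mult_left_iff)
    moreover have "\<not> (b \<and> c)"
    proof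
      assume "b \<and> c"
      then obtain y y' where y: "y \<in> {1..<q}" "p * y = q * y'" unfolding abc by metis
      hence "q dvd p * y" by simp
      hence "q dvd y" using coprime_p_q by (simp add: coprime_dvd_mult_right_iff coprime_commute)
      thus False using y(1) by (auto dest: dvd_imp_le)
    qed
    ultimately show ?thesis unfolding DH_sequence_eq[OF that] abc[symmetric]
      by (cases a; cases b; cases c) simp_all
  qed
  have "p > 0" "q > 0" using P.p_gt_1 Q.p_gt_1 by auto
  have "dft (p * q) (\<lambda>i. to_ac (DH_sequence p q g f i)) (u * v)
      = (\<Sum>i<p * q. of_bool (coprime i (p * q) \<and> Q.upper_class i) * (u * v) ^ i)
        + (\<Sum>i<p * q. of_bool (\<exists>y\<in>{1..<q}. i = p * y \<and> Q.upper_class y) * (u * v) ^ i)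
        + (\<Sum>i<q * p. of_bool (\<exists>y\<in>{1..<p}. i = q * y \<and> P.upper_class y) * (u * v) ^ i)"
    unfolding dft_def mult.commute[of q p] sum.distrib[symmetric]
    by (intro sum.cong refl) (simp only: eq distrib_right lessThan_iff)
  also have "\<dots> = (if u = 1 then 0 else Q.upper_sum v) + Q.upper_sum ((u * v) ^ p) + P.upper_sum ((u * v) ^ q)"
    using sum_units[OF assms] Q.sum_multiples[OF \<open>p > 0\<close>, of "u * v"]
      P.sum_multiples[OF \<open>q > 0\<close>, of "u * v"] by simp
  finally show ?thesis by (simp add: power_mult_distrib assms)
qed

section \<open>Counting the zeros of the transform\<close>

lemma card_coincident_roots:
  assumes t: "[2 = gp ^ t] (mod p)" and t': "[2 = gq ^ t'] (mod q)" and m: "[p = gq ^ m] (mod q)"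
  shows "4 * card {(v, u). v ^ q = 1 \<and> v \<noteq> 1 \<and> u ^ p = 1 \<and> u \<noteq> 1 \<and> Q.upper_sum v + Q.upper_sum (v ^ p) = P.upper_sum (u ^ q)} =
    (if 8 dvd t \<and> (4 dvd t' \<or> 4 dvd m) then 2
     else if 4 dvd t \<and> \<not> 8 dvd t \<and> \<not> 4 dvd t' \<and> even m \<and> \<not> 4 dvd m then 2
     else if 4 dvd t \<and> \<not> 4 dvd t' \<and> odd m then 1 else 0) * (p - 1) * (q - 1)"
proof -
  obtain z :: gf2_closure where z: "z ^ p = 1" "z \<noteq> 1"
    using ex_root_of_unity[OF P.odd_p P.p_gt_1] by blast
  obtain w :: gf2_closure where w: "w ^ q = 1" "w \<noteq> 1"
    using ex_root_of_unity[OF Q.odd_p Q.p_gt_1] by blast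
  note zq = nontrivial_root_power[OF P.prime_p z coprime_p_q]
  \<comment> \<open>In these coordinates \<open>v ^ p\<close> is a shift of the index by
    \<open>m\<close>, and \<open>u ^ q\<close> merely replaces the base root \<open>z\<close> by
    \<open>z ^ q\<close>.\<close>
  define F where "F = map_prod (\<lambda>n. w ^ (gq ^ n)) (\<lambda>l. z ^ (gp ^ l))"
  have F: "bij_betw F ({..<q - 1} \<times> {..<p - 1}) (({v. v ^ q = 1} - {1}) \<times> ({u. u ^ p = 1} - {1}))"
    unfolding F_def by (rule bij_betw_map_prod[OF Q.bij_betw_nontrivial_roots[OF w] P.bij_betw_nontrivial_roots[OF z]])
  have w_p: "(w ^ (gq ^ n)) ^ p = w ^ (gq ^ (n + m))" for n
    unfolding power_add power_mult
    by (rule root_of_unity_power_cong[OF power_root_of_unity[OF w(1)] m])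
  have z_q: "(z ^ (gp ^ l)) ^ q = (z ^ q) ^ (gp ^ l)" for l
    by (simp only: power_mult[symmetric] mult.commute)
  define C where "C = {(v, u). v ^ q = 1 \<and> v \<noteq> 1 \<and> u ^ p = 1 \<and> u \<noteq> 1 \<and> Q.upper_sum v + Q.upper_sum (v ^ p) = P.upper_sum (u ^ q)}"
  define C' where "C' = {(n, l). n < q - 1 \<and> l < p - 1 \<and>
    Q.upper_sum (w ^ (gq ^ n)) + Q.upper_sum (w ^ (gq ^ (n + m))) = P.upper_sum ((z ^ q) ^ (gp ^ l))}"
  have C: "C = {x \<in> ({v. v ^ q = 1} - {1}) \<times> ({u. u ^ p = 1} - {1}). x \<in> C}"
    by (auto simp: C_def)
  have "F (n, l) \<in> C \<longleftrightarrow> (n, l) \<in> C'" if "n < q - 1" "l < p - 1" for n l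
  proof -
    have "F (n, l) \<in> ({v. v ^ q = 1} - {1}) \<times> ({u. u ^ p = 1} - {1})"
      using bij_betw_apply[OF F, of "(n, l)"] that by simp
    thus ?thesis using w_p[of n] z_q[of l] that by (simp add: F_def C_def C'_def)
  qed
  hence C': "{a \<in> {..<q - 1} \<times> {..<p - 1}. F a \<in> C} = C'"
    by (auto simp: C'_def)
  have "card C = card C'"
    using card_filter_bij_betw[OF F, of "\<lambda>x. x \<in> C"] unfolding C[symmetric] C' .
  thus ?thesis
    using card_coincidences[OF P.octic_sums_upper_sum[OF zq t] Q.octic_sums_upper_sum[OF w t'], of m]
    unfolding C_def[symmetric] C'_def[symmetric] by (rule ssubst)
qed

text \<open>The zeros \<open>u * v\<close> of the transform are sorted by which of \<open>u\<close>
  and \<open>v\<close> equal 1: both, only \<open>v\<close>, only \<open>u\<close>, or neither. The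
  additive form avoids subtraction of naturals.\<close>

lemma linear_complexity_eq:
  "linear_complexity (DH_sequence p q g f) +
    (1 + card {u. u ^ p = 1 \<and> u \<noteq> 1 \<and> P.upper_sum (u ^ q) = 0} + card {v. v ^ q = 1 \<and> v \<noteq> 1 \<and> Q.upper_sum (v ^ p) = 0}
      + card {(v, u). v ^ q = 1 \<and> v \<noteq> 1 \<and> u ^ p = 1 \<and> u \<noteq> 1 \<and> Q.upper_sum v + Q.upper_sum (v ^ p) = P.upper_sum (u ^ q)}) = p * q"
proof -
  define d :: "gf2_closure \<Rightarrow> gf2_closure" where "d = dft (p * q) (\<lambda>i. to_ac (DH_sequence p q g f i))"
  have d: "d (u * v) = (if u = 1 then 0 else Q.upper_sum v) + Q.upper_sum (v ^ p) + P.upper_sum (u ^ q)"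
    if "u ^ p = 1" "v ^ q = 1" for u v
    using that unfolding d_def by (rule dft_DH_sequence)
  note bij = bij_betw_roots_of_unity_mult[OF coprime_p_q, where 'a = gf2_closure]
  have card_N: "card {x :: gf2_closure. x ^ (p * q) = 1} = p * q"
    using bij_betw_same_card[OF bij]
    by (simp add: card_cartesian_product P.card_roots_of_unity Q.card_roots_of_unity)
  have N: "p * q > 0" using P.p_gt_1 Q.p_gt_1 by simp
  have fin: "finite {x :: gf2_closure. x ^ (p * q) = 1}"
    using card_N N by (metis card.infinite less_numeral_extra(3))
  define A where "A = {u. u ^ p = 1 \<and> u \<noteq> 1 \<and> P.upper_sum (u ^ q) = 0}"
  define B where "B = {v. v ^ q = 1 \<and> v \<noteq> 1 \<and> Q.upper_sum (v ^ p) = 0}"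
  define C where "C = {(v, u). v ^ q = 1 \<and> v \<noteq> 1 \<and> u ^ p = 1 \<and> u \<noteq> 1 \<and> Q.upper_sum v + Q.upper_sum (v ^ p) = P.upper_sum (u ^ q)}"
  have fin_p: "finite {u :: gf2_closure. u ^ p = 1}" and fin_q: "finite {u :: gf2_closure. u ^ q = 1}"
    using P.card_roots_of_unity Q.card_roots_of_unity P.p_gt_1 Q.p_gt_1
    by (metis card.infinite not_one_less_zero)+
  have fin_A: "finite A" and fin_B: "finite B"
    using fin_p fin_q by (auto simp: A_def B_def elim!: rev_finite_subset)
  have fin_C: "finite C"
    by (rule finite_subset[OF _ finite_cartesian_product[OF fin_q fin_p]]) (auto simp: C_def)
  define Z where "Z = {x \<in> {u. u ^ p = 1} \<times> {v. v ^ q = 1}. d (case x of (u, v) \<Rightarrow> u * v) = 0}"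
  have "Z = insert (1, 1) ((\<lambda>u. (u, 1)) ` A \<union> (Pair 1 ` B \<union> prod.swap ` C))"
  proof (rule Set.set_eqI)
    fix x :: "gf2_closure \<times> gf2_closure"
    obtain u v where x: "x = (u, v)" by force
    have "x \<in> Z \<longleftrightarrow> u ^ p = 1 \<and> v ^ q = 1 \<and> (if u = 1 then 0 else Q.upper_sum v) + Q.upper_sum (v ^ p) + P.upper_sum (u ^ q) = 0"
      by (simp add: Z_def x d cong: conj_cong)
    also have "\<dots> \<longleftrightarrow> x \<in> insert (1, 1) ((\<lambda>u. (u, 1)) ` A \<union> (Pair 1 ` B \<union> prod.swap ` C))"
      by (cases "u = 1"; cases "v = 1")
         (auto simp: x A_def B_def C_def P.upper_sum_1 Q.upper_sum_1 image_iff add_eq_0_iff_eq)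
    finally show "x \<in> Z \<longleftrightarrow> \<dots>" .
  qed
  also have "card \<dots> = 1 + card ((\<lambda>u. (u, 1)) ` A \<union> (Pair 1 ` B \<union> prod.swap ` C))"
    using fin_A fin_B fin_C by (subst card_insert_disjoint) (auto simp: A_def B_def C_def)
  also have "card ((\<lambda>u. (u, 1)) ` A \<union> (Pair 1 ` B \<union> prod.swap ` C))
      = card ((\<lambda>u. (u, 1 :: gf2_closure)) ` A) + card (Pair (1 :: gf2_closure) ` B \<union> prod.swap ` C)"
    using fin_A fin_B fin_C by (subst card_Un_disjoint) (auto simp: A_def B_def C_def)
  also have "card (Pair (1 :: gf2_closure) ` B \<union> prod.swap ` C)
      = card (Pair (1 :: gf2_closure) ` B) + card (prod.swap ` C)"
    using fin_B fin_C by (subst card_Un_disjoint) (auto simp: B_def C_def)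
  also have "card (prod.swap ` C) = card C"
    by (rule card_image) (auto simp: inj_on_def)
  finally have "card Z = 1 + card A + card B + card C"
    by (simp add: card_image inj_on_def)
  moreover have "card Z = card {x \<in> {x. x ^ (p * q) = 1}. d x = 0}"
    unfolding Z_def by (rule card_filter_bij_betw[OF bij, symmetric])
  moreover have "linear_complexity (DH_sequence p q g f) = card {x. x ^ (p * q) = 1 \<and> d x \<noteq> 0}"
    unfolding d_def
  proof (rule linear_complexity_eq_card_dft_support[OF card_N _ _ N])
    show "DH_sequence p q g f (i + p * q) = DH_sequence p q g f i" for i
      by (simp add: DH_sequence_def)
    \<comment> \<open>Index 4 lies in the upper half, so the term at \<open>p * y\<close> is a 1 of
      the sequence.\<close>
    define y where "y = gq ^ 4 mod q"
    have y: "y \<in> {1..<q}"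
      using bij_betw_apply[OF Q.bij_betw_power, of 4] Q.p_ge_9 by (simp add: y_def)
    moreover have "Q.upper_class y" unfolding y_def Q.upper_class_power_iff by simp
    moreover have "p * y < p * q" using y P.p_gt_1 by simp
    ultimately show "DH_sequence p q g f (p * y) \<noteq> 0"
      by (subst DH_sequence_eq) auto
  qed
  moreover have "card {x. x ^ (p * q) = 1 \<and> d x \<noteq> 0} + card {x \<in> {x. x ^ (p * q) = 1}. d x = 0} = p * q"
  proof -
    have "{x. x ^ (p * q) = 1 \<and> d x \<noteq> 0} \<union> {x \<in> {x. x ^ (p * q) = 1}. d x = 0} = {x. x ^ (p * q) = 1}"
      by auto
    thus ?thesis using fin by (subst card_Un_disjoint[symmetric]) (auto simp: card_N)
  qed
  ultimately show ?thesis unfolding A_def[symmetric] B_def[symmetric] C_def[symmetric] by linarith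
qed

text \<open>The indices of 2 modulo both primes and of \<open>p\<close> modulo \<open>q\<close> turn
  all residue symbols into divisibility by 2, 4 or 8, the form in which the zeros have been
  counted.\<close>

lemma real_linear_complexity:
  "real (linear_complexity (DH_sequence p q g f)) =
     real p * real q - 1 - eps p * (real p - 1) - kappa q * (real q - 1)
       - theta p q * (real p - 1) * (real q - 1)"
proof -
  have "coprime p 2" "coprime q 2" using P.odd_p Q.odd_p by auto
  then obtain t t' where t: "[2 = gp ^ t] (mod p)" and t': "[2 = gq ^ t'] (mod q)"
    using P.ex_index Q.ex_index by metis
  obtain m where m: "[p = gq ^ m] (mod q)"
    using Q.ex_index[of p] coprime_p_q by (auto simp: coprime_commute)
  define A where "A = card {u. u ^ p = 1 \<and> u \<noteq> 1 \<and> P.upper_sum (u ^ q) = 0}"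
  define B where "B = card {v. v ^ q = 1 \<and> v \<noteq> 1 \<and> Q.upper_sum (v ^ p) = 0}"
  define C where "C = card {(v, u). v ^ q = 1 \<and> v \<noteq> 1 \<and> u ^ p = 1 \<and> u \<noteq> 1 \<and> Q.upper_sum v + Q.upper_sum (v ^ p) = P.upper_sum (u ^ q)}"
  have dvd: "k dvd p - 1" "k dvd q - 1" if "k \<in> {2, 4, 8}" for k
    using that P.dvd8 Q.dvd8 dvd_trans[of k 8] by auto
  have res: "power_residue k 2 p \<longleftrightarrow> k dvd t" "power_residue k 2 q \<longleftrightarrow> k dvd t'"
    "power_residue k (int p) q \<longleftrightarrow> k dvd m" if "k \<in> {2, 4, 8}" for k
    using P.power_residue_iff_dvd[OF dvd(1)[OF that] _ t] Q.power_residue_iff_dvd[OF dvd(2)[OF that] _ t']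
      Q.power_residue_iff_dvd[OF dvd(2)[OF that] _ m] that by auto
  have p1: "real (p - 1) = real p - 1" and q1: "real (q - 1) = real q - 1"
    using P.p_gt_1 Q.p_gt_1 by simp_all
  have "2 * A = (if 8 dvd t then p - 1 else 0)"
    unfolding A_def using coprime_p_q t by (rule P.card_upper_sum_zeros)
  hence "2 * real A = (if 8 dvd t then real p - 1 else 0)"
    unfolding p1[symmetric] by (metis of_nat_0 of_nat_mult of_nat_numeral)
  hence A: "real A = eps p * (real p - 1)"
    by (auto simp: eps_def res split: if_splits)
  have "2 * B = (if 8 dvd t' then q - 1 else 0)"
    unfolding B_def using coprime_p_q t' by (intro Q.card_upper_sum_zeros) (simp_all add: coprime_commute)
  hence "2 * real B = (if 8 dvd t' then real q - 1 else 0)"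
    unfolding q1[symmetric] by (metis of_nat_0 of_nat_mult of_nat_numeral)
  hence B: "real B = kappa q * (real q - 1)"
    by (auto simp: kappa_def res split: if_splits)
  \<comment> \<open>This is four times \<open>theta p q\<close>; the first two cases of
    \<open>theta\<close> merge into one.\<close>
  define n :: nat where "n = (if 8 dvd t \<and> (4 dvd t' \<or> 4 dvd m) then 2
     else if 4 dvd t \<and> \<not> 8 dvd t \<and> \<not> 4 dvd t' \<and> even m \<and> \<not> 4 dvd m then 2
     else if 4 dvd t \<and> \<not> 4 dvd t' \<and> odd m then 1 else 0)"
  have "4 * C = n * (p - 1) * (q - 1)"
    unfolding C_def n_def by (rule card_coincident_roots[OF t t' m])
  hence C4: "4 * real C = real n * (real p - 1) * (real q - 1)"
    unfolding p1[symmetric] q1[symmetric] by (metis of_nat_mult of_nat_numeral)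
  have th: "theta p q = real n / 4"
  proof -
    have "8 dvd t \<Longrightarrow> 4 dvd t" "4 dvd m \<Longrightarrow> even m"
      using dvd_trans[of 4 8 t] dvd_trans[of 2 4 m] by simp_all
    thus ?thesis unfolding theta_def n_def by (auto simp: res)
  qed
  have C: "real C = theta p q * (real p - 1) * (real q - 1)"
    unfolding th using C4 by simp
  have "real (linear_complexity (DH_sequence p q g f)) + (1 + real A + real B + real C) = real p * real q"
    using arg_cong[OF linear_complexity_eq, of real]
    unfolding A_def[symmetric] B_def[symmetric] C_def[symmetric] of_nat_add of_nat_1 of_nat_mult .
  thus ?thesis unfolding A B C by linarith
qed

end

theorem theorem1:
  fixes p q :: nat
  assumes "prime p" and "prime q" and "gcd (p - 1) (q - 1) = 8"
  shows "(\<forall>g f. DH_parameters p q g f \<longrightarrow>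
            real (linear_complexity (DH_sequence p q g f)) =
              real p * real q - 1 - eps p * (real p - 1) - kappa q * (real q - 1)
                - theta p q * (real p - 1) * (real q - 1))
       \<and> (\<forall>g f g' f'. DH_parameters p q g f \<longrightarrow> DH_parameters p q g' f' \<longrightarrow>
            linear_complexity (DH_sequence p q g f) = linear_complexity (DH_sequence p q g' f'))"
proof -
  have real_lc: "real (linear_complexity (DH_sequence p q g f)) =
      real p * real q - 1 - eps p * (real p - 1) - kappa q * (real q - 1)
        - theta p q * (real p - 1) * (real q - 1)" if "DH_parameters p q g f" for g f
  proof -
    have "p > 0" "q > 0" using assms(1,2) by (simp_all add: prime_gt_0_nat)
    interpret ding_helleseth p "nat (g mod int p)" q "nat (g mod int q)" g f
    proof unfold_locales
      show "8 dvd p - 1" "8 dvd q - 1" using assms(3) by (metis gcd_dvd1, metis gcd_dvd2)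
    qed (use assms that \<open>p > 0\<close> \<open>q > 0\<close> in
          \<open>simp_all add: DH_parameters_def common_primitive_root_def cong_def\<close>)
    show ?thesis by (rule real_linear_complexity)
  qed
  show ?thesis
  proof (intro conjI allI impI)
    fix g f g' f' assume "DH_parameters p q g f" "DH_parameters p q g' f'"
    from real_lc[OF this(1)] real_lc[OF this(2)]
    show "linear_complexity (DH_sequence p q g f) = linear_complexity (DH_sequence p q g' f')"
      by (metis of_nat_eq_iff)
  qed (rule real_lc)
qed

end
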